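(* Let $m\ge1$ be an integer and let $\mathbf v\in\mathcal B^*=\bigcup_{l\ge1}\mathbf W^{-l}(G)$. The equation $\mathrm{rot}^{2m}\mathbf u=\mathbf v$ is solvable in the space $\mathbf W^m(G)$ if and only if $\mathbf v\in\mathbf W^{-m}(G)$. Its solution $\mathbf u=S^{-2m}\mathbf v=\sum_{j\ge1}\lambda_j^{-2m}\left[(\mathbf v,\mathbf q_j^+)\mathbf q_j^++(\mathbf v,\mathbf q_j^-)\mathbf q_j^-\right]$ is uniquely determined in the quotient space $\mathcal B(G)/\mathcal B_H(G)$.
   Context: $G\subset\mathbb R^3$ is a bounded connected domain with smooth boundary $\Gamma$, $\mathbf n$ is the unit normal on $\Gamma$, $\gamma$ denotes the trace on $\Gamma$; $\mathbf L_2(G)$ is the real Hilbert space of square integrable vector fields with inner product $(\mathbf u,\mathbf v)=\int_G\mathbf u\cdot\mathbf v\,d\mathbf x$. $\mathcal B=\mathcal B(G)$ is the orthogonal complement of $\{\nabla h:h\in H^1(G)\}$ in $\mathbf L_2(G)$; $\mathcal B_H=\{\mathbf u\in\mathbf L_2(G):\mathrm{div}\,\mathbf u=0,\ \mathrm{rot}\,\mathbf u=0\text{ in }G,\ \gamma(\mathbf n\cdot\mathbf u)=0\}$; $\mathbf V^0$ is the orthogonal complement of $\mathcal B_H$ in $\mathcal B$. $S$ is the self-adjoint operator in $\mathbf V^0$ with domain $\mathbf W^1=\{\mathbf f\in\mathbf V^0:\mathrm{rot}\,\mathbf f\in\mathbf V^0\}$, $S\mathbf f=\mathrm{rot}\,\mathbf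 f$. Standing convention: the eigenvalues of $S$ come in pairs $\pm\lambda_j$, $0<\lambda_1\le\lambda_2\le\dots$, and $\{\mathbf q_j^+,\mathbf q_j^-\}_{j\ge1}$ is an orthonormal basis of $\mathbf V^0$ with $\mathbf q_j^\pm\in\mathbf C^\infty(\overline G)$, $\mathrm{rot}\,\mathbf q_j^\pm=\pm\lambda_j\mathbf q_j^\pm$, $\gamma(\mathbf n\cdot\mathbf q_j^\pm)=0$. For $m\ge1$, $\mathbf W^m=\{\mathbf f\in\mathbf V^0,\ \mathrm{rot}\,\mathbf f\in\mathbf V^0,\dots,\mathrm{rot}^m\mathbf f\in\mathbf V^0\}$; on it $\mathrm{rot}^m=S^m$, $S^m\mathbf f=\sum_j\lambda_j^m[(\mathbf f,\mathbf q_j^+)\mathbf q_j^++(-1)^m(\mathbf f,\mathbf q_j^-)\mathbf q_j^-]$. $\mathbf W^{-m}$ is the space of functionals $\mathbf v$ given by coefficients $(\mathbf v,\mathbf q_j^\pm)\in\mathbb R$ (and vanishing on $\mathcal B_H$) with $\sum_j\lambda_j^{-2m}[(\mathbf v,\mathbf q_j^+)^2+(\mathbf v,\mathbf q_j^-)^2]<\infty$; the pairing with $\mathbf w\in\mathbf W^m$ is $\sum_j[(\mathbf v,\mathbf q_j^+)(\mathbf w,\mathbf q_j^+)+(\mathbf v,\mathbf q_j^-)(\mathbf w,\mathbf q_j^-)]$. For $\mathbf u\in\mathbf W^m$, the equation $\mathrm{rot}^{2m}\mathbf u=\mathbf v$ means $(\mathrm{rot}^m\mathbf u,\mathrm{rot}^m\mathbf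 q_j^\pm)=(\mathbf v,\mathbf q_j^\pm)$ for all $j\ge1$ and both signs. Uniqueness in $\mathcal B/\mathcal B_H$ means that two solutions differ by an element of $\mathcal B_H$. *)

theory Defs
  imports "HOL-Analysis.Analysis"
begin

section \<open>Smooth functions and smooth domains\<close>

text \<open>Intended for open \<open>S\<close>; the derivatives taken are the partial derivatives.\<close>

primrec C_k_on :: "nat \<Rightarrow> 'a::euclidean_space set \<Rightarrow> ('a \<Rightarrow> 'b::real_normed_vector) \<Rightarrow> bool" where
  "C_k_on 0 S f \<longleftrightarrow> continuous_on S f"
| "C_k_on (Suc k) S f \<longleftrightarrow>
     (\<forall>x\<in>S. f differentiable (at x)) \<and>
     (\<forall>b\<in>Basis. C_k_on k S (\<lambda>x. frechet_derivative f (at x) b))"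

definition smooth_on :: "'a::euclidean_space set \<Rightarrow> ('a \<Rightarrow> 'b::real_normed_vector) \<Rightarrow> bool" where
  "smooth_on S f \<longleftrightarrow> (\<forall>k. C_k_on k S f)"

text \<open>The space of functions that are smooth up to the boundary: restrictions to the closure of
  smooth functions on the whole space.\<close>

definition smooth_closure :: "'a::euclidean_space set \<Rightarrow> ('a \<Rightarrow> 'b::real_normed_vector) set" where
  "smooth_closure G = {f. \<exists>F. smooth_on UNIV F \<and> (\<forall>x\<in>closure G. F x = f x)}"

definition test_function :: "'a::euclidean_space set \<Rightarrow> ('a \<Rightarrow> 'b::real_normed_vector) \<Rightarrow> bool" where
  "test_function G \<phi> \<longleftrightarrow>
     smooth_on UNIV \<phi> \<and> (\<exists>K. compact K \<and> K \<subseteq> G \<and> (\<forall>x. x \<notin> K \<longrightarrow> \<phi> x = 0))"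

definition partial_deriv :: "3 \<Rightarrow> (real^3 \<Rightarrow> real) \<Rightarrow> real^3 \<Rightarrow> real" where
  "partial_deriv i f x = frechet_derivative f (at x) (axis i 1)"

definition grad :: "(real^3 \<Rightarrow> real) \<Rightarrow> real^3 \<Rightarrow> real^3" where
  "grad f x = (\<chi> i. partial_deriv i f x)"

definition curl :: "(real^3 \<Rightarrow> real^3) \<Rightarrow> real^3 \<Rightarrow> real^3" where
  "curl f x = vector
     [partial_deriv 2 (\<lambda>y. f y $ 3) x - partial_deriv 3 (\<lambda>y. f y $ 2) x,
      partial_deriv 3 (\<lambda>y. f y $ 1) x - partial_deriv 1 (\<lambda>y. f y $ 3) x,
      partial_deriv 1 (\<lambda>y. f y $ 2) x - partial_deriv 2 (\<lambda>y. f y $ 1) x]"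

definition local_defining_function ::
  "(real^3) set \<Rightarrow> real^3 \<Rightarrow> (real^3) set \<Rightarrow> (real^3 \<Rightarrow> real) \<Rightarrow> bool" where
  "local_defining_function G x U \<rho> \<longleftrightarrow>
     open U \<and> x \<in> U \<and> smooth_on U \<rho> \<and> (\<forall>y\<in>U. grad \<rho> y \<noteq> 0) \<and>
     G \<inter> U = {y\<in>U. \<rho> y < 0} \<and> frontier G \<inter> U = {y\<in>U. \<rho> y = 0}"

definition smooth_bounded_domain :: "(real^3) set \<Rightarrow> bool" where
  "smooth_bounded_domain G \<longleftrightarrow>
     open G \<and> connected G \<and> G \<noteq> {} \<and> bounded G \<and>
     (\<forall>x\<in>frontier G. \<exists>U \<rho>. local_defining_function G x U \<rho>)"

text \<open>The outward unit normal at a boundary point of a smooth domain; it does not depend on the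
  choice of the local defining function.\<close>

definition unit_normal :: "(real^3) set \<Rightarrow> real^3 \<Rightarrow> real^3" where
  "unit_normal G x =
     (THE n. \<exists>U \<rho>. local_defining_function G x U \<rho> \<and> n = grad \<rho> x /\<^sub>R norm (grad \<rho> x))"

section \<open>Square integrable functions and distributional derivatives\<close>

text \<open>Elements of \<open>L\<^sub>2(G)\<close> are represented by functions on the whole space; only their values
  almost everywhere in \<open>G\<close> matter.\<close>

definition L2 :: "'a::euclidean_space set \<Rightarrow> ('a \<Rightarrow> 'b::euclidean_space) set" where
  "L2 G = {f. f \<in> borel_measurable (lebesgue_on G) \<and>
              integrable (lebesgue_on G) (\<lambda>x. (norm (f x))\<^sup>2)}"

definition L2_inner ::
  "'a::euclidean_space set \<Rightarrow> ('a \<Rightarrow> 'b::euclidean_space) \<Rightarrow> ('a \<Rightarrow> 'b) \<Rightarrow> real" where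
  "L2_inner G f g = (LINT x|lebesgue_on G. f x \<bullet> g x)"

definition L2_norm :: "'a::euclidean_space set \<Rightarrow> ('a \<Rightarrow> 'b::euclidean_space) \<Rightarrow> real" where
  "L2_norm G f = sqrt (L2_inner G f f)"

definition L2_eq ::
  "'a::euclidean_space set \<Rightarrow> ('a \<Rightarrow> 'b::euclidean_space) \<Rightarrow> ('a \<Rightarrow> 'b) \<Rightarrow> bool" where
  "L2_eq G f g \<longleftrightarrow> (AE x in lebesgue_on G. f x = g x)"

definition L2_sums ::
  "'a::euclidean_space set \<Rightarrow> (nat \<Rightarrow> 'a \<Rightarrow> 'b::euclidean_space) \<Rightarrow> ('a \<Rightarrow> 'b) \<Rightarrow> bool" where
  "L2_sums G F u \<longleftrightarrow> (\<forall>j\<ge>1. F j \<in> L2 G) \<and> u \<in> L2 G \<and>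
     (\<lambda>N. L2_norm G (\<lambda>x. u x - (\<Sum>j=1..N. F j x))) \<longlonglongrightarrow> 0"

text \<open>\<open>weak_grad G h g\<close> expresses that \<open>h \<in> H\<^sup>1(G)\<close> with gradient \<open>g\<close>.\<close>

definition weak_grad :: "(real^3) set \<Rightarrow> (real^3 \<Rightarrow> real) \<Rightarrow> (real^3 \<Rightarrow> real^3) \<Rightarrow> bool" where
  "weak_grad G h g \<longleftrightarrow> h \<in> L2 G \<and> g \<in> L2 G \<and>
     (\<forall>\<phi>. test_function G \<phi> \<longrightarrow>
        (\<forall>i. L2_inner G h (partial_deriv i \<phi>) = - L2_inner G (\<lambda>x. g x $ i) \<phi>))"

definition weak_div :: "(real^3) set \<Rightarrow> (real^3 \<Rightarrow> real^3) \<Rightarrow> (real^3 \<Rightarrow> real) \<Rightarrow> bool" where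
  "weak_div G f d \<longleftrightarrow> f \<in> L2 G \<and> d \<in> L2 G \<and>
     (\<forall>\<phi>. test_function G \<phi> \<longrightarrow> L2_inner G f (grad \<phi>) = - L2_inner G d \<phi>)"

definition weak_rot :: "(real^3) set \<Rightarrow> (real^3 \<Rightarrow> real^3) \<Rightarrow> (real^3 \<Rightarrow> real^3) \<Rightarrow> bool" where
  "weak_rot G f g \<longleftrightarrow> f \<in> L2 G \<and> g \<in> L2 G \<and>
     (\<forall>\<phi>. test_function G \<phi> \<longrightarrow> L2_inner G f (curl \<phi>) = L2_inner G g \<phi>)"

text \<open>The distributional rotor, for fields for which it lies in \<open>L\<^sub>2(G)\<close>. It is unique up to
  null sets, and fields that agree almost everywhere in \<open>G\<close> get the same value.\<close>

definition rot :: "(real^3) set \<Rightarrow> (real^3 \<Rightarrow> real^3) \<Rightarrow> real^3 \<Rightarrow> real^3" where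
  "rot G f = (SOME g. weak_rot G f g)"

text \<open>For a square integrable field \<open>f\<close> with square integrable divergence \<open>d\<close>, the trace
  \<open>\<gamma>(n \<cdot> f)\<close> is the functional on traces of \<open>h \<in> H\<^sup>1(G)\<close> given by Green's formula,
  namely \<open>(f, \<nabla>h) + (d, h)\<close>.\<close>

definition normal_trace_zero :: "(real^3) set \<Rightarrow> (real^3 \<Rightarrow> real^3) \<Rightarrow> bool" where
  "normal_trace_zero G f \<longleftrightarrow>
     (\<exists>d. weak_div G f d \<and> (\<forall>h g. weak_grad G h g \<longrightarrow> L2_inner G f g + L2_inner G d h = 0))"

section \<open>The spaces of fields\<close>

definition B_space :: "(real^3) set \<Rightarrow> (real^3 \<Rightarrow> real^3) set" where
  "B_space G = {u \<in> L2 G. \<forall>h g. weak_grad G h g \<longrightarrow> L2_inner G u g = 0}"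

definition B_H :: "(real^3) set \<Rightarrow> (real^3 \<Rightarrow> real^3) set" where
  "B_H G = {u \<in> L2 G. weak_div G u (\<lambda>_. 0) \<and> weak_rot G u (\<lambda>_. 0) \<and> normal_trace_zero G u}"

definition V0 :: "(real^3) set \<Rightarrow> (real^3 \<Rightarrow> real^3) set" where
  "V0 G = {u \<in> B_space G. \<forall>w\<in>B_H G. L2_inner G u w = 0}"

text \<open>The second conjunct says that the iterated rotors occurring in the first one exist
  in \<open>L\<^sub>2(G)\<close>. The operator \<open>S\<close> is \<open>rot G\<close> on the domain \<open>W G 1\<close>.\<close>

definition W :: "(real^3) set \<Rightarrow> nat \<Rightarrow> (real^3 \<Rightarrow> real^3) set" where
  "W G m = {f. (\<forall>k\<le>m. (rot G ^^ k) f \<in> V0 G) \<and>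
               (\<forall>k<m. \<exists>g. weak_rot G ((rot G ^^ k) f) g)}"

section \<open>The eigenbasis and the dual scale\<close>

text \<open>Only indices \<open>j \<ge> 1\<close> are used. A field in \<open>smooth_closure G\<close> is continuous on the closure,
  so its normal trace is taken pointwise.\<close>

definition curl_eigenbasis ::
  "(real^3) set \<Rightarrow> (nat \<Rightarrow> real) \<Rightarrow> (nat \<Rightarrow> real^3 \<Rightarrow> real^3) \<Rightarrow> (nat \<Rightarrow> real^3 \<Rightarrow> real^3) \<Rightarrow> bool" where
  "curl_eigenbasis G lam qp qm \<longleftrightarrow>
     (\<forall>j\<ge>1. 0 < lam j \<and> lam j \<le> lam (Suc j)) \<and>
     (\<forall>j\<ge>1. qp j \<in> smooth_closure G \<and> qm j \<in> smooth_closure G) \<and>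
     (\<forall>j\<ge>1. qp j \<in> W G 1 \<and> L2_eq G (rot G (qp j)) (\<lambda>x. lam j *\<^sub>R qp j x)) \<and>
     (\<forall>j\<ge>1. qm j \<in> W G 1 \<and> L2_eq G (rot G (qm j)) (\<lambda>x. - lam j *\<^sub>R qm j x)) \<and>
     (\<forall>j\<ge>1. \<forall>x\<in>frontier G. unit_normal G x \<bullet> qp j x = 0 \<and> unit_normal G x \<bullet> qm j x = 0) \<and>
     (\<forall>i\<ge>1. \<forall>j\<ge>1. L2_inner G (qp i) (qp j) = (if i = j then 1 else 0) \<and>
                   L2_inner G (qm i) (qm j) = (if i = j then 1 else 0) \<and>
                   L2_inner G (qp i) (qm j) = 0) \<and>
     (\<forall>f\<in>V0 G. L2_sums G
        (\<lambda>j x. L2_inner G f (qp j) *\<^sub>R qp j x + L2_inner G f (qm j) *\<^sub>R qm j x) f)"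

text \<open>The functional with coefficients \<open>a j\<close> at \<open>qp j\<close> and \<open>b j\<close> at \<open>qm j\<close>. By
  orthonormality its values at \<open>qp j\<close> and \<open>qm j\<close> are these coefficients, and it vanishes on every
  field orthogonal to the eigenbasis, in particular on \<open>B_H G\<close>. The infinite sum is \<open>0\<close>, by
  convention, at fields for which the pairing series does not converge absolutely; thus the
  functional is determined by its coefficients alone, and the spaces \<open>W_neg\<close> below
  are literally nested.\<close>

definition dual_functional ::
  "(real^3) set \<Rightarrow> (nat \<Rightarrow> real^3 \<Rightarrow> real^3) \<Rightarrow> (nat \<Rightarrow> real^3 \<Rightarrow> real^3) \<Rightarrow>
   (nat \<Rightarrow> real) \<Rightarrow> (nat \<Rightarrow> real) \<Rightarrow> (real^3 \<Rightarrow> real^3) \<Rightarrow> real" where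
  "dual_functional G qp qm a b w =
     (\<Sum>\<^sub>\<infinity>j\<in>{1..}. a j * L2_inner G w (qp j) + b j * L2_inner G w (qm j))"

definition W_neg ::
  "(real^3) set \<Rightarrow> (nat \<Rightarrow> real) \<Rightarrow> (nat \<Rightarrow> real^3 \<Rightarrow> real^3) \<Rightarrow> (nat \<Rightarrow> real^3 \<Rightarrow> real^3) \<Rightarrow>
   nat \<Rightarrow> ((real^3 \<Rightarrow> real^3) \<Rightarrow> real) set" where
  "W_neg G lam qp qm m = {dual_functional G qp qm a b | a b.
     (\<lambda>j. lam j powi (- 2 * int m) * ((a j)\<^sup>2 + (b j)\<^sup>2)) summable_on {1..}}"

definition B_star ::
  "(real^3) set \<Rightarrow> (nat \<Rightarrow> real) \<Rightarrow> (nat \<Rightarrow> real^3 \<Rightarrow> real^3) \<Rightarrow> (nat \<Rightarrow> real^3 \<Rightarrow> real^3) \<Rightarrow>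
   ((real^3 \<Rightarrow> real^3) \<Rightarrow> real) set" where
  "B_star G lam qp qm = (\<Union>l\<in>{1..}. W_neg G lam qp qm l)"

text \<open>The spectral formula for \<open>S\<^sup>kv\<close>, for integer \<open>k\<close>; meaningful when the series
  converges in \<open>L\<^sub>2(G)\<close>.\<close>

definition S_power ::
  "(real^3) set \<Rightarrow> (nat \<Rightarrow> real) \<Rightarrow> (nat \<Rightarrow> real^3 \<Rightarrow> real^3) \<Rightarrow> (nat \<Rightarrow> real^3 \<Rightarrow> real^3) \<Rightarrow>
   int \<Rightarrow> ((real^3 \<Rightarrow> real^3) \<Rightarrow> real) \<Rightarrow> real^3 \<Rightarrow> real^3" where
  "S_power G lam qp qm k v = (SOME u. L2_sums G
     (\<lambda>j x. lam j powi k *\<^sub>R (v (qp j) *\<^sub>R qp j x + ((-1) powi k * v (qm j)) *\<^sub>R qm j x)) u)"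

text \<open>The meaning of the equation \<open>rot\<^sup>2\<^sup>m u = v\<close> for \<open>u \<in> W G m\<close>.\<close>

definition solves_rot_eq ::
  "(real^3) set \<Rightarrow> (nat \<Rightarrow> real^3 \<Rightarrow> real^3) \<Rightarrow> (nat \<Rightarrow> real^3 \<Rightarrow> real^3) \<Rightarrow> nat \<Rightarrow>
   (real^3 \<Rightarrow> real^3) \<Rightarrow> ((real^3 \<Rightarrow> real^3) \<Rightarrow> real) \<Rightarrow> bool" where
  "solves_rot_eq G qp qm m u v \<longleftrightarrow>
     (\<forall>j\<ge>1. L2_inner G ((rot G ^^ m) u) ((rot G ^^ m) (qp j)) = v (qp j) \<and>
            L2_inner G ((rot G ^^ m) u) ((rot G ^^ m) (qm j)) = v (qm j))"

end

(*
  Integration by parts for the rotor on V^0 needs no boundary regularity here. The eigenvalues are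
  bounded away from 0 and the weak rotor is closed, so every g in V^0 is the rotor of a
  field u in V^0 obtained by dividing the eigencoefficients of g. If also g = rot f with f in V^0,
  then f - u is curl-free, hence (being orthogonal to gradients) lies in B_H, and it is orthogonal
  to B_H; so f = u. Thus rot acts on coefficients by multiplication with +-lambda_j, u in W^m solves
  rot^{2m} u = v iff its coefficients are lambda_j^{-2m} (v, q_j), and Bessel's inequality and
  completeness of L_2 turn square summability into solvability.
*)
theory Submission
  imports Defs
begin

section \<open>The space of square integrable functions\<close>

text \<open>The symmetry (rot f, q) = (f, rot q) cannot be read off from \<open>weak_rot\<close>: it
  tests only against fields with compact support in \<open>G\<close>, and an eigenfield q need not
  have one. Hence the detour through a preimage and the trivial kernel of the rotor on
  \<open>V0\<close>. The second obstacle is that fields are functions, not classes: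
  \<open>rot G f\<close> is a choice among weak rotors, and each iterate
  \<open>(rot G ^^ k) u\<close> starts from an earlier choice. Relations between iterates are
  therefore carried by \<open>weak_rot\<close> and \<open>L2_eq\<close>, and a series computed by
  hand is matched with the chosen rotor by uniqueness almost everywhere. That uniqueness is the
  fundamental lemma of the calculus of variations, which is why bump functions are constructed.
  Integration by parts itself enters once: test functions have their classical gradient as weak
  gradient, so that orthogonality to weak gradients yields the zero divergence that
  \<open>B_H\<close> demands.\<close>

lemma L2_measurable: "f \<in> L2 G \<Longrightarrow> f \<in> borel_measurable (lebesgue_on G)"
  by (simp add: L2_def)

lemma integrable_L2_inner:
  assumes "f \<in> L2 G" "g \<in> L2 G"
  shows "integrable (lebesgue_on G) (\<lambda>x. f x \<bullet> g x)"
proof (rule Bochner_Integration.integrable_bound)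
  show "integrable (lebesgue_on G) (\<lambda>x. (norm (f x))\<^sup>2 + (norm (g x))\<^sup>2)"
    using assms by (simp add: L2_def)
  show "(\<lambda>x. f x \<bullet> g x) \<in> borel_measurable (lebesgue_on G)"
    using assms by (intro borel_measurable_inner L2_measurable)
  have "\<bar>f x \<bullet> g x\<bar> \<le> (norm (f x))\<^sup>2 + (norm (g x))\<^sup>2" for x
  proof -
    have "\<bar>f x \<bullet> g x\<bar> \<le> norm (f x) * norm (g x)" by (rule Cauchy_Schwarz_ineq2)
    moreover have "2 * (norm (f x) * norm (g x)) \<le> (norm (f x))\<^sup>2 + (norm (g x))\<^sup>2"
      using sum_squares_bound[of "norm (f x)" "norm (g x)"] by simp
    moreover have "0 \<le> norm (f x) * norm (g x)" by simp
    ultimately show ?thesis by linarith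
  qed
  then show "AE x in lebesgue_on G. norm (f x \<bullet> g x) \<le> norm ((norm (f x))\<^sup>2 + (norm (g x))\<^sup>2)"
    by simp
qed

lemma L2_add:
  assumes "f \<in> L2 G" "g \<in> L2 G"
  shows "(\<lambda>x. f x + g x) \<in> L2 G"
proof -
  have "integrable (lebesgue_on G) (\<lambda>x. f x \<bullet> f x + 2 * (f x \<bullet> g x) + g x \<bullet> g x)"
    using assms by (intro Bochner_Integration.integrable_add integrable_mult_right integrable_L2_inner)
  moreover have "(\<lambda>x. (norm (f x + g x))\<^sup>2) = (\<lambda>x. f x \<bullet> f x + 2 * (f x \<bullet> g x) + g x \<bullet> g x)"
    by (auto simp: power2_norm_eq_inner inner_add inner_commute)
  ultimately show ?thesis using assms by (auto simp: L2_def intro: borel_measurable_add)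
qed

lemma L2_scaleR: "f \<in> L2 G \<Longrightarrow> (\<lambda>x. c *\<^sub>R f x) \<in> L2 G"
  by (auto simp: L2_def power_mult_distrib intro: borel_measurable_scaleR)

lemma L2_diff: "f \<in> L2 G \<Longrightarrow> g \<in> L2 G \<Longrightarrow> (\<lambda>x. f x - g x) \<in> L2 G"
  using L2_add[of f G "\<lambda>x. (-1) *\<^sub>R g x"] L2_scaleR[of g G "-1"] by simp

lemma L2_zero: "(\<lambda>x. 0) \<in> L2 G"
  by (simp add: L2_def)

lemma L2_sum: "(\<And>j. j \<in> J \<Longrightarrow> F j \<in> L2 G) \<Longrightarrow> (\<lambda>x. \<Sum>j\<in>J. F j x) \<in> L2 G"
  by (induction J rule: infinite_finite_induct) (auto intro: L2_add L2_zero)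

lemmas L2_intros = L2_add L2_diff L2_scaleR L2_zero L2_sum

lemma L2_inner_commute: "L2_inner G f g = L2_inner G g f"
  by (simp add: L2_inner_def inner_commute)

lemma L2_inner_add_left:
  "f \<in> L2 G \<Longrightarrow> g \<in> L2 G \<Longrightarrow> h \<in> L2 G \<Longrightarrow>
   L2_inner G (\<lambda>x. f x + g x) h = L2_inner G f h + L2_inner G g h"
  unfolding L2_inner_def inner_add_left
  by (intro Bochner_Integration.integral_add integrable_L2_inner)

lemma L2_inner_diff_left:
  "f \<in> L2 G \<Longrightarrow> g \<in> L2 G \<Longrightarrow> h \<in> L2 G \<Longrightarrow>
   L2_inner G (\<lambda>x. f x - g x) h = L2_inner G f h - L2_inner G g h"
  unfolding L2_inner_def inner_diff_left
  by (intro Bochner_Integration.integral_diff integrable_L2_inner)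

lemma L2_inner_scaleR_left: "L2_inner G (\<lambda>x. c *\<^sub>R f x) h = c * L2_inner G f h"
  by (simp add: L2_inner_def)

lemma L2_inner_sum_left:
  assumes "\<And>j. j \<in> J \<Longrightarrow> F j \<in> L2 G" "h \<in> L2 G"
  shows "L2_inner G (\<lambda>x. \<Sum>j\<in>J. F j x) h = (\<Sum>j\<in>J. L2_inner G (F j) h)"
  using assms(1)
proof (induction J rule: infinite_finite_induct)
  case (insert i J)
  then show ?case by (simp add: L2_inner_add_left L2_sum assms(2))
qed (simp_all add: L2_inner_def)

lemma L2_inner_add_right:
  "f \<in> L2 G \<Longrightarrow> g \<in> L2 G \<Longrightarrow> h \<in> L2 G \<Longrightarrow>
   L2_inner G h (\<lambda>x. f x + g x) = L2_inner G h f + L2_inner G h g"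
  by (simp add: L2_inner_commute[of G h] L2_inner_add_left)

lemma L2_inner_diff_right:
  "f \<in> L2 G \<Longrightarrow> g \<in> L2 G \<Longrightarrow> h \<in> L2 G \<Longrightarrow>
   L2_inner G h (\<lambda>x. f x - g x) = L2_inner G h f - L2_inner G h g"
  by (simp add: L2_inner_commute[of G h] L2_inner_diff_left)

lemma L2_inner_scaleR_right: "L2_inner G h (\<lambda>x. c *\<^sub>R f x) = c * L2_inner G h f"
  by (simp add: L2_inner_def)

lemma L2_inner_zero_left: "L2_inner G (\<lambda>x. 0) g = 0"
  by (simp add: L2_inner_def)

lemma L2_inner_nonneg: "0 \<le> L2_inner G f f"
  unfolding L2_inner_def by (rule Bochner_Integration.integral_nonneg) simp

lemma L2_norm_nonneg: "0 \<le> L2_norm G f"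
  by (simp add: L2_norm_def L2_inner_nonneg)

lemma L2_norm_power2: "(L2_norm G f)\<^sup>2 = L2_inner G f f"
  by (simp add: L2_norm_def L2_inner_nonneg)

text \<open>The quadratic t -> (f + t g, f + t g) is nonnegative. On functions the form is only
  semidefinite, so the case (g, g) = 0 is treated separately.\<close>

lemma L2_Cauchy_Schwarz:
  assumes f: "f \<in> L2 G" and g: "g \<in> L2 G"
  shows "\<bar>L2_inner G f g\<bar> \<le> L2_norm G f * L2_norm G g"
proof -
  have q: "0 \<le> L2_inner G f f + 2 * t * L2_inner G f g + t\<^sup>2 * L2_inner G g g" for t
  proof -
    have "L2_inner G (\<lambda>x. f x + t *\<^sub>R g x) (\<lambda>x. f x + t *\<^sub>R g x) =
      L2_inner G f f + 2 * t * L2_inner G f g + t\<^sup>2 * L2_inner G g g"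
      using f g by (simp add: L2_inner_add_left L2_inner_add_right L2_inner_scaleR_left
          L2_inner_scaleR_right L2_intros L2_inner_commute[of G g f] power2_eq_square algebra_simps)
    then show ?thesis by (metis L2_inner_nonneg)
  qed
  have "(L2_inner G f g)\<^sup>2 \<le> L2_inner G f f * L2_inner G g g"
  proof (cases "L2_inner G g g = 0")
    case True
    have "L2_inner G f g = 0"
    proof (rule ccontr)
      assume "L2_inner G f g \<noteq> 0"
      then show False
        \<comment> \<open>Here the quadratic is affine in t, and this t gives it the value
          -1.\<close>
        using q[of "- (L2_inner G f f + 1) / (2 * L2_inner G f g)"] True by (simp add: field_simps)
    qed
    then show ?thesis by (simp add: True)
  next
    case False
    then have "0 < L2_inner G g g" using L2_inner_nonneg[of G g] by linarith
    then show ?thesis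
      \<comment> \<open>This is the minimiser of the quadratic in t.\<close>
      using q[of "- L2_inner G f g / L2_inner G g g"]
      by (simp add: field_simps power2_eq_square)
  qed
  then have "\<bar>L2_inner G f g\<bar> \<le> sqrt (L2_inner G f f * L2_inner G g g)"
    by (intro real_le_rsqrt) simp
  then show ?thesis by (simp add: L2_norm_def real_sqrt_mult)
qed

lemma L2_norm_triangle:
  assumes f: "f \<in> L2 G" and g: "g \<in> L2 G"
  shows "L2_norm G (\<lambda>x. f x + g x) \<le> L2_norm G f + L2_norm G g"
proof (rule power2_le_imp_le)
  have "(L2_norm G (\<lambda>x. f x + g x))\<^sup>2 = L2_inner G f f + 2 * L2_inner G f g + L2_inner G g g"
    using f g by (simp add: L2_norm_power2 L2_inner_add_left L2_inner_add_right
       L2_intros L2_inner_commute[of G g f])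
  also have "\<dots> \<le> L2_inner G f f + 2 * (L2_norm G f * L2_norm G g) + L2_inner G g g"
    using L2_Cauchy_Schwarz[OF f g] by linarith
  also have "\<dots> = (L2_norm G f + L2_norm G g)\<^sup>2"
    by (simp add: power2_sum L2_norm_power2)
  finally show "(L2_norm G (\<lambda>x. f x + g x))\<^sup>2 \<le> (L2_norm G f + L2_norm G g)\<^sup>2" .
qed (simp add: L2_norm_nonneg)

lemma L2_norm_minus_commute: "L2_norm G (\<lambda>x. f x - g x) = L2_norm G (\<lambda>x. g x - f x)"
proof -
  have "(\<lambda>x. (f x - g x) \<bullet> (f x - g x)) = (\<lambda>x. (g x - f x) \<bullet> (g x - f x))"
    by (auto simp: inner_diff inner_commute)
  then show ?thesis by (simp add: L2_norm_def L2_inner_def)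
qed

lemma L2_norm_eq_0_iff:
  assumes "f \<in> L2 G"
  shows "L2_norm G f = 0 \<longleftrightarrow> (AE x in lebesgue_on G. f x = 0)"
proof -
  have "L2_norm G f = 0 \<longleftrightarrow> (AE x in lebesgue_on G. f x \<bullet> f x = 0)"
    unfolding L2_norm_def L2_inner_def real_sqrt_eq_0_iff
    by (rule integral_nonneg_eq_0_iff_AE) (simp_all add: integrable_L2_inner assms)
  then show ?thesis by simp
qed

lemma L2_inner_cong_AE:
  assumes "f \<in> borel_measurable (lebesgue_on G)" "f' \<in> borel_measurable (lebesgue_on G)"
   "g \<in> borel_measurable (lebesgue_on G)" "g' \<in> borel_measurable (lebesgue_on G)"
   "L2_eq G f f'" "L2_eq G g g'"
  shows "L2_inner G f g = L2_inner G f' g'"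
  unfolding L2_inner_def
proof (rule integral_cong_AE)
  show "AE x in lebesgue_on G. f x \<bullet> g x = f' x \<bullet> g' x"
    using assms(5,6) unfolding L2_eq_def by eventually_elim simp
qed (use assms in simp_all)

lemma L2_eq_refl: "L2_eq G f f" by (simp add: L2_eq_def)

lemma L2_eq_sym: "L2_eq G f g \<Longrightarrow> L2_eq G g f"
  unfolding L2_eq_def by (auto elim: eventually_mono)

lemma L2_norm_diff_eq_0_iff:
  assumes "f \<in> L2 G" "g \<in> L2 G"
  shows "L2_norm G (\<lambda>x. f x - g x) = 0 \<longleftrightarrow> L2_eq G f g"
  using L2_norm_eq_0_iff[OF L2_diff[OF assms]] by (simp add: L2_eq_def)

lemma tendsto_L2_inner_left:
  assumes "\<And>n. U n \<in> L2 G" "u \<in> L2 G" "g \<in> L2 G"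
    and lim: "(\<lambda>n. L2_norm G (\<lambda>x. u x - U n x)) \<longlonglongrightarrow> 0"
  shows "(\<lambda>n. L2_inner G (U n) g) \<longlonglongrightarrow> L2_inner G u g"
proof -
  have "(\<lambda>n. L2_inner G u g - L2_inner G (U n) g) \<longlonglongrightarrow> 0"
  proof (rule tendsto_rabs_zero_cancel, rule tendsto_sandwich[OF _ _ tendsto_const])
    have "\<bar>L2_inner G u g - L2_inner G (U n) g\<bar> \<le> L2_norm G (\<lambda>x. u x - U n x) * L2_norm G g" for n
      using L2_Cauchy_Schwarz[OF L2_diff[OF assms(2,1)] assms(3)]
      by (simp add: L2_inner_diff_left assms)
    then show "\<forall>\<^sub>F n in sequentially. \<bar>L2_inner G u g - L2_inner G (U n) g\<bar>
        \<le> L2_norm G (\<lambda>x. u x - U n x) * L2_norm G g" by simp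
    show "(\<lambda>n. L2_norm G (\<lambda>x. u x - U n x) * L2_norm G g) \<longlonglongrightarrow> 0"
      using tendsto_mult_left_zero[OF lim] by simp
  qed auto
  from tendsto_diff[OF tendsto_const[of "L2_inner G u g"] this] show ?thesis by simp
qed

lemma L2_limit_unique:
  assumes "\<And>n. U n \<in> L2 G" "u \<in> L2 G" "w \<in> L2 G"
    and "(\<lambda>n. L2_norm G (\<lambda>x. u x - U n x)) \<longlonglongrightarrow> 0"
    and "(\<lambda>n. L2_norm G (\<lambda>x. w x - U n x)) \<longlonglongrightarrow> 0"
  shows "L2_eq G u w"
proof -
  have "L2_norm G (\<lambda>x. u x - w x) \<le> L2_norm G (\<lambda>x. u x - U n x) + L2_norm G (\<lambda>x. w x - U n x)" for n
    using L2_norm_triangle[of "\<lambda>x. u x - U n x" G "\<lambda>x. U n x - w x"] assms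
    by (simp add: L2_diff L2_norm_minus_commute[of G w])
  then have "L2_norm G (\<lambda>x. u x - w x) \<le> 0"
    using tendsto_add[OF assms(4,5)] by (intro LIMSEQ_le_const[where a = "L2_norm G (\<lambda>x. u x - w x)"]) auto
  then show ?thesis
    using L2_norm_nonneg[of G "\<lambda>x. u x - w x"] L2_norm_diff_eq_0_iff[OF assms(2,3)] by simp
qed

section \<open>Completeness\<close>

text \<open>Fatou's lemma speaks of nonnegative integrals, before integrability is known. This turns
  its bound into membership in \<open>L2\<close> and a norm estimate at once.\<close>

lemma L2_norm_le_of_nn_integral:
  assumes "f \<in> borel_measurable (lebesgue_on G)" "0 \<le> C"
    and "(\<integral>\<^sup>+x. ennreal ((norm (f x))\<^sup>2) \<partial>lebesgue_on G) \<le> ennreal (C\<^sup>2)"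
  shows "f \<in> L2 G" "L2_norm G f \<le> C"
proof -
  have int: "integrable (lebesgue_on G) (\<lambda>x. (norm (f x))\<^sup>2)"
    using assms by (intro integrableI_nonneg) (auto intro: order.strict_trans1)
  then show "f \<in> L2 G" using assms by (simp add: L2_def)
  have "ennreal (L2_inner G f f) \<le> ennreal (C\<^sup>2)"
    using assms(3) nn_integral_eq_integral[OF int]
    by (simp add: L2_inner_def dot_square_norm)
  then have "L2_inner G f f \<le> C\<^sup>2" by simp
  then show "L2_norm G f \<le> C"
    using assms(2) unfolding L2_norm_def by (intro real_le_lsqrt) (auto simp: L2_inner_nonneg)
qed

lemma nn_integral_L2:
  assumes "f \<in> L2 G"
  shows "(\<integral>\<^sup>+x. ennreal ((norm (f x))\<^sup>2) \<partial>lebesgue_on G) = ennreal ((L2_norm G f)\<^sup>2)"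
  using assms nn_integral_eq_integral[of "lebesgue_on G" "\<lambda>x. (norm (f x))\<^sup>2"]
  by (simp add: L2_def L2_norm_power2 L2_inner_def dot_square_norm)

lemma L2_const:
  assumes "G \<in> lmeasurable"
  shows "(\<lambda>x. c) \<in> L2 G"
proof -
  interpret finite_measure "lebesgue_on G"
    using assms by (intro finite_measure_lebesgue_on)
  show ?thesis by (simp add: L2_def)
qed

text \<open>Cauchy-Schwarz for |f| against the constant 1, whose norm is the square root of the
  volume of \<open>G\<close>: on a set of finite measure the \<open>L2\<close> norm controls the L1
  norm.\<close>

lemma nn_integral_norm_L2:
  fixes f :: "'a::euclidean_space \<Rightarrow> 'b::euclidean_space"
  assumes "G \<in> lmeasurable" "f \<in> L2 G"
  shows "(\<integral>\<^sup>+x. ennreal (norm (f x)) \<partial>lebesgue_on G) \<le> ennreal (L2_norm G f * L2_norm G (\<lambda>x. 1::real))"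
proof -
  have n: "(\<lambda>x. norm (f x)) \<in> L2 G"
    using assms(2) by (auto simp: L2_def)
  note c = L2_const[OF assms(1), of "1::real"]
  have int: "integrable (lebesgue_on G) (\<lambda>x. norm (f x))"
    using integrable_L2_inner[OF n c] by simp
  have "L2_inner G (\<lambda>x. norm (f x)) (\<lambda>x. 1) \<le> L2_norm G (\<lambda>x. norm (f x)) * L2_norm G (\<lambda>x. 1::real)"
    using L2_Cauchy_Schwarz[OF n c] by simp
  also have "L2_norm G (\<lambda>x. norm (f x)) = L2_norm G f"
    by (simp add: L2_norm_def L2_inner_def dot_square_norm power2_eq_square)
  finally show ?thesis
    using nn_integral_eq_integral[OF int] by (simp add: L2_inner_def ennreal_leI)
qed

text \<open>The L1 norms of the increments are bounded by a geometric series, so the sum of the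
  absolute increments has finite integral and is finite almost everywhere. At such points the
  telescoping series converges absolutely.\<close>

lemma L2_rapidly_Cauchy_AE_convergent:
  fixes U :: "nat \<Rightarrow> 'a::euclidean_space \<Rightarrow> 'b::euclidean_space"
  assumes G: "G \<in> lmeasurable" and U: "\<And>n. U n \<in> L2 G"
    and fast: "\<And>k. L2_norm G (\<lambda>x. U (Suc k) x - U k x) \<le> (1/2)^k"
  shows "AE x in lebesgue_on G. convergent (\<lambda>k. U k x)"
proof -
  let ?M = "lebesgue_on G"
  have [measurable]: "U k \<in> borel_measurable ?M" for k
    using U L2_measurable by blast
  define C where "C = L2_norm G (\<lambda>x. 1::real)"
  have C: "0 \<le> C" by (simp add: C_def L2_norm_nonneg)
  have "(\<integral>\<^sup>+x. (\<Sum>k. ennreal (norm (U (Suc k) x - U k x))) \<partial>?M)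
      = (\<Sum>k. \<integral>\<^sup>+x. ennreal (norm (U (Suc k) x - U k x)) \<partial>?M)"
    by (intro nn_integral_suminf) measurable
  also have "\<dots> \<le> (\<Sum>k. ennreal ((1/2)^k * C))"
  proof (intro suminf_le summableI)
    fix k
    have "(\<integral>\<^sup>+x. ennreal (norm (U (Suc k) x - U k x)) \<partial>?M)
        \<le> ennreal (L2_norm G (\<lambda>x. U (Suc k) x - U k x) * C)"
      unfolding C_def by (intro nn_integral_norm_L2 G L2_diff U)
    also have "\<dots> \<le> ennreal ((1/2)^k * C)"
      by (intro ennreal_leI mult_right_mono fast C)
    finally show "(\<integral>\<^sup>+x. ennreal (norm (U (Suc k) x - U k x)) \<partial>?M) \<le> ennreal ((1/2)^k * C)" .
  qed
  also have "\<dots> = ennreal (\<Sum>k. (1/2)^k * C)"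
    using C by (intro suminf_ennreal2 summable_mult2) (auto simp: summable_geometric)
  also have "\<dots> < \<infinity>" by simp
  finally have "AE x in ?M. (\<Sum>k. ennreal (norm (U (Suc k) x - U k x))) \<noteq> \<infinity>"
    by (intro nn_integral_PInf_AE) auto
  then show ?thesis
  proof eventually_elim
    case (elim x)
    then have "summable (\<lambda>k. norm (U (Suc k) x - U k x))"
      by (intro summable_suminf_not_top) auto
    then have "summable (\<lambda>k. U (Suc k) x - U k x)"
      by (rule summable_norm_cancel)
    then have "convergent (\<lambda>n. \<Sum>k<n. U (Suc k) x - U k x)"
      by (simp add: summable_iff_convergent)
    then have "convergent (\<lambda>n. U n x - U 0 x)"
      by (simp only: sum_lessThan_telescope[of "\<lambda>k. U k x"])
    then show "convergent (\<lambda>n. U n x)"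
      using convergent_diff_const_right_iff by blast
  qed
qed

text \<open>Riesz-Fischer: a rapidly Cauchy subsequence supplies a pointwise limit, and Fatou's
  lemma upgrades pointwise convergence of the subsequence to norm convergence of the whole
  sequence.\<close>

proposition L2_complete:
  fixes U :: "nat \<Rightarrow> 'a::euclidean_space \<Rightarrow> 'b::euclidean_space"
  assumes G: "G \<in> lmeasurable" and U: "\<And>n. U n \<in> L2 G"
    and Cauchy: "\<And>e. 0 < e \<Longrightarrow> \<exists>N. \<forall>m\<ge>N. \<forall>n\<ge>N. L2_norm G (\<lambda>x. U m x - U n x) \<le> e"
  obtains u where "u \<in> L2 G" "(\<lambda>n. L2_norm G (\<lambda>x. u x - U n x)) \<longlonglongrightarrow> 0"
proof -
  let ?M = "lebesgue_on G"
  have meas [measurable]: "U k \<in> borel_measurable ?M" for k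
    using U L2_measurable by blast
  have "\<exists>N. \<forall>k. \<forall>m\<ge>N k. \<forall>n\<ge>N k. L2_norm G (\<lambda>x. U m x - U n x) \<le> (1/2)^k"
    by (intro choice allI Cauchy) simp
  then obtain N where N: "\<And>k m n. N k \<le> m \<Longrightarrow> N k \<le> n \<Longrightarrow> L2_norm G (\<lambda>x. U m x - U n x) \<le> (1/2)^k"
    by blast
  \<comment> \<open>Partial sums dominate each \<open>N k\<close> and are monotone; the added 1
    forces \<open>k \<le> r k\<close>, so that the indices go to infinity.\<close>
  define r where "r k = (\<Sum>i\<le>k. N i + 1)" for k
  have r: "N k \<le> r k" "k \<le> r k" "r k \<le> r (Suc k)" for k
  proof -
    show "N k \<le> r k" unfolding r_def by (cases k) auto
    show "k \<le> r k" unfolding r_def by (induction k) auto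
    show "r k \<le> r (Suc k)" unfolding r_def by simp
  qed
  have "AE x in ?M. convergent (\<lambda>k. U (r k) x)"
    using r by (intro L2_rapidly_Cauchy_AE_convergent G U N) (auto intro: order.trans)
  then have lim: "AE x in ?M. (\<lambda>k. U (r k) x) \<longlonglongrightarrow> lim (\<lambda>k. U (r k) x)"
    by (simp add: convergent_LIMSEQ_iff)
  define u where "u x = lim (\<lambda>k. U (r k) x)" for x
  have u_meas [measurable]: "u \<in> borel_measurable ?M"
    unfolding u_def by (rule borel_measurable_lim_metric) simp
  \<comment> \<open>Fatou along the subsequence: a bound on the distances of the later terms to
    \<open>U n\<close> passes to the limit \<open>u\<close>.\<close>
  have close: "(\<lambda>x. u x - U n x) \<in> L2 G" "L2_norm G (\<lambda>x. u x - U n x) \<le> e"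
    if e: "0 < e" and far: "\<And>m. n \<le> m \<Longrightarrow> L2_norm G (\<lambda>x. U m x - U n x) \<le> e" for n e
  proof -
    have "(\<integral>\<^sup>+x. ennreal ((norm (u x - U n x))\<^sup>2) \<partial>?M)
      = (\<integral>\<^sup>+x. liminf (\<lambda>k. ennreal ((norm (U (r k) x - U n x))\<^sup>2)) \<partial>?M)"
    proof (rule nn_integral_cong_AE, use lim in eventually_elim)
      case (elim x)
      then have "(\<lambda>k. ennreal ((norm (U (r k) x - U n x))\<^sup>2)) \<longlonglongrightarrow> ennreal ((norm (u x - U n x))\<^sup>2)"
        unfolding u_def by (intro tendsto_intros)
      then show ?case by (intro lim_imp_Liminf[symmetric]) simp_all
    qed
    also have "\<dots> \<le> liminf (\<lambda>k. \<integral>\<^sup>+x. ennreal ((norm (U (r k) x - U n x))\<^sup>2) \<partial>?M)"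
      by (rule nn_integral_liminf) measurable
    also have "\<dots> = liminf (\<lambda>k. ennreal ((L2_norm G (\<lambda>x. U (r k) x - U n x))\<^sup>2))"
      by (simp add: nn_integral_L2[OF L2_diff[OF U U]])
    also have "\<dots> \<le> ennreal (e\<^sup>2)"
    proof (rule Liminf_le)
      have "ennreal ((L2_norm G (\<lambda>x. U (r k) x - U n x))\<^sup>2) \<le> ennreal (e\<^sup>2)" if "n \<le> k" for k
        using that r(2)[of k] by (intro ennreal_leI power_mono far L2_norm_nonneg) linarith
      then show "\<forall>\<^sub>F k in sequentially. ennreal ((L2_norm G (\<lambda>x. U (r k) x - U n x))\<^sup>2) \<le> ennreal (e\<^sup>2)"
        by (auto simp: eventually_sequentially)
    qed simp
    finally have le: "(\<integral>\<^sup>+x. ennreal ((norm (u x - U n x))\<^sup>2) \<partial>?M) \<le> ennreal (e\<^sup>2)" .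
    show "(\<lambda>x. u x - U n x) \<in> L2 G" "L2_norm G (\<lambda>x. u x - U n x) \<le> e"
      using e by (intro L2_norm_le_of_nn_integral(1)[OF _ _ le] L2_norm_le_of_nn_integral(2)[OF _ _ le]; simp)+
  qed
  obtain n0 where "\<And>m. n0 \<le> m \<Longrightarrow> L2_norm G (\<lambda>x. U m x - U n0 x) \<le> 1"
    using Cauchy[of 1] by auto
  then have "(\<lambda>x. u x - U n0 x) \<in> L2 G" by (intro close(1)[of 1]) auto
  then have "u \<in> L2 G" using L2_add[OF _ U[of n0]] by fastforce
  moreover have "(\<lambda>n. L2_norm G (\<lambda>x. u x - U n x)) \<longlonglongrightarrow> 0"
  proof (rule LIMSEQ_I)
    fix e :: real assume e: "0 < e"
    obtain K where K: "\<And>m n. K \<le> m \<Longrightarrow> K \<le> n \<Longrightarrow> L2_norm G (\<lambda>x. U m x - U n x) \<le> e/2"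
      using Cauchy[of "e/2"] e by auto
    have "L2_norm G (\<lambda>x. u x - U n x) \<le> e/2" if "K \<le> n" for n
      using e that by (intro close(2) K) auto
    then have "L2_norm G (\<lambda>x. u x - U n x) < e" if "K \<le> n" for n
      using e that by fastforce
    then show "\<exists>no. \<forall>n\<ge>no. norm (L2_norm G (\<lambda>x. u x - U n x) - 0) < e"
      by (intro exI[of _ K]) (simp add: L2_norm_nonneg)
  qed
  ultimately show ?thesis by (rule that)
qed

section \<open>Integration by parts for test functions\<close>

lemma smooth_on_UNIV_D:
  assumes "smooth_on UNIV f"
  shows "f differentiable (at x)" "continuous_on UNIV f"
    and "b \<in> Basis \<Longrightarrow> continuous_on UNIV (\<lambda>x. frechet_derivative f (at x) b)"
proof -
  have "C_k_on (Suc 0) UNIV f" using assms by (simp add: smooth_on_def del: C_k_on.simps)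
  then show "f differentiable (at x)"
    and "b \<in> Basis \<Longrightarrow> continuous_on UNIV (\<lambda>x. frechet_derivative f (at x) b)"
    by simp_all
  have "C_k_on 0 UNIV f" using assms by (simp add: smooth_on_def del: C_k_on.simps)
  then show "continuous_on UNIV f" by simp
qed

lemma L2_continuous:
  fixes f :: "'a::euclidean_space \<Rightarrow> 'b::euclidean_space"
  assumes "continuous_on UNIV f" "open G" "bounded G"
  shows "f \<in> L2 G"
proof -
  have G: "G \<in> sets lebesgue" "G \<in> lmeasurable"
    using assms(2,3) by (auto intro: lmeasurable_open)
  interpret finite_measure "lebesgue_on G"
    using G(2) by (intro finite_measure_lebesgue_on)
  have meas: "f \<in> borel_measurable (lebesgue_on G)"
    using assms(1) G by (intro continuous_imp_measurable_on_sets_lebesgue) (auto intro: continuous_on_subset)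
  have "compact (closure G)" using assms(3) by simp
  then have "bounded (f ` closure G)"
    using assms(1) by (meson compact_continuous_image compact_imp_bounded continuous_on_subset top_greatest)
  then obtain B where B: "\<And>x. x \<in> closure G \<Longrightarrow> norm (f x) \<le> B"
    by (auto simp: bounded_iff)
  have "integrable (lebesgue_on G) (\<lambda>x. (norm (f x))\<^sup>2)"
  proof (rule integrable_const_bound[where B = "B\<^sup>2"])
    have "(norm (f x))\<^sup>2 \<le> B\<^sup>2" if "x \<in> G" for x
      using B[of x] that closure_subset[of G] by (intro power_mono) auto
    then show "AE x in lebesgue_on G. norm ((norm (f x))\<^sup>2) \<le> B\<^sup>2"
      by (auto simp: space_restrict_space)
  qed (use meas in simp)
  then show ?thesis using meas by (simp add: L2_def)
qed

lemma test_function_L2: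
  fixes \<phi> :: "'a::euclidean_space \<Rightarrow> 'b::euclidean_space"
  assumes "open G" "bounded G" "test_function G \<phi>"
  shows "\<phi> \<in> L2 G"
  using assms by (intro L2_continuous smooth_on_UNIV_D) (auto simp: test_function_def)

lemma continuous_on_partial_deriv:
  assumes "smooth_on UNIV f"
  shows "continuous_on UNIV (partial_deriv i f)"
  unfolding partial_deriv_def
  by (rule smooth_on_UNIV_D(3)[OF assms]) simp

lemma frechet_derivative_vec_nth:
  fixes f :: "'a::real_normed_vector \<Rightarrow> real^'n"
  assumes "f differentiable (at x)"
  shows "frechet_derivative (\<lambda>y. f y $ j) (at x) b = frechet_derivative f (at x) b $ j"
proof -
  have "((\<lambda>y. f y $ j) has_derivative (\<lambda>b. frechet_derivative f (at x) b $ j)) (at x)"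
    using assms[unfolded frechet_derivative_works] by (rule bounded_linear.has_derivative[OF bounded_linear_vec_nth])
  from frechet_derivative_at[OF this, symmetric] show ?thesis by simp
qed

lemma continuous_on_partial_deriv_vec_nth:
  fixes f :: "real^3 \<Rightarrow> real^3"
  assumes "smooth_on UNIV f"
  shows "continuous_on UNIV (partial_deriv i (\<lambda>y. f y $ j))"
proof -
  have "partial_deriv i (\<lambda>y. f y $ j) = (\<lambda>x. frechet_derivative f (at x) (axis i 1) $ j)"
    by (simp add: fun_eq_iff partial_deriv_def frechet_derivative_vec_nth smooth_on_UNIV_D(1)[OF assms])
  then show ?thesis
    using smooth_on_UNIV_D(3)[OF assms, of "axis i 1"]
    by (simp add: continuous_on_component)
qed

lemma continuous_on_curl:
  assumes "smooth_on UNIV f"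
  shows "continuous_on UNIV (curl f)"
proof -
  note c = continuous_on_partial_deriv_vec_nth[OF assms]
  have "continuous_on UNIV (\<lambda>x. \<chi> k. curl f x $ k)"
  proof (rule continuous_on_vec_lambda)
    fix k :: 3
    consider "k = 1" | "k = 2" | "k = 3" using exhaust_3 by blast
    then show "continuous_on UNIV (\<lambda>x. curl f x $ k)"
      by cases (auto simp: curl_def intro!: continuous_on_diff c)
  qed
  then show ?thesis by simp
qed

lemma continuous_on_grad:
  assumes "smooth_on UNIV f"
  shows "continuous_on UNIV (grad f)"
  using continuous_on_partial_deriv[OF assms] unfolding grad_def
  by (intro continuous_on_vec_lambda)

lemma has_real_derivative_along_line:
  fixes F :: "'a::real_normed_vector \<Rightarrow> real"
  assumes "F differentiable (at (x + t *\<^sub>R e))"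
  shows "((\<lambda>s. F (x + s *\<^sub>R e)) has_real_derivative frechet_derivative F (at (x + t *\<^sub>R e)) e) (at t)"
proof -
  have "((\<lambda>s. x + s *\<^sub>R e) has_derivative (\<lambda>s. s *\<^sub>R e)) (at t)"
    by (auto intro!: derivative_eq_intros)
  from has_derivative_compose[OF this assms[unfolded frechet_derivative_works]]
  have "((\<lambda>s. F (x + s *\<^sub>R e)) has_derivative (\<lambda>s. frechet_derivative F (at (x + t *\<^sub>R e)) (s *\<^sub>R e))) (at t)" .
  moreover have "frechet_derivative F (at (x + t *\<^sub>R e)) (s *\<^sub>R e) = frechet_derivative F (at (x + t *\<^sub>R e)) e * s" for s
    using linear_frechet_derivative[OF assms] by (simp add: linear_cmul)
  ultimately show ?thesis by (simp add: has_field_derivative_def)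
qed

lemma frechet_derivative_outside_support:
  fixes F :: "'a::real_normed_vector \<Rightarrow> 'b::real_normed_vector"
  assumes "closed K" "\<And>x. x \<notin> K \<Longrightarrow> F x = 0" "x \<notin> K"
  shows "frechet_derivative F (at x) e = 0"
proof -
  have "(F has_derivative (\<lambda>_. 0)) (at x)"
  proof (rule has_derivative_transform_within_open[OF has_derivative_const])
    show "open (- K)" using assms(1) by (rule open_Compl)
  qed (use assms in auto)
  from frechet_derivative_at[OF this, symmetric] show ?thesis by simp
qed

lemma bounded_compact_support:
  fixes f :: "'a::topological_space \<Rightarrow> 'b::real_normed_vector"
  assumes "continuous_on UNIV f" "compact K" "\<And>x. x \<notin> K \<Longrightarrow> f x = 0"
  obtains B where "0 \<le> B" "\<And>x. norm (f x) \<le> B"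
proof -
  have "bounded (f ` K)"
    using assms(1,2) by (meson compact_continuous_image compact_imp_bounded continuous_on_subset top_greatest)
  then obtain B where B: "\<And>x. x \<in> K \<Longrightarrow> norm (f x) \<le> B" by (auto simp: bounded_iff)
  have "norm (f x) \<le> max 0 B" for x
    using B[of x] assms(3)[of x] by (cases "x \<in> K") auto
  then show ?thesis by (intro that[of "max 0 B"]) auto
qed

lemma integrable_compact_support:
  fixes f :: "'a::euclidean_space \<Rightarrow> 'b::euclidean_space"
  assumes "continuous_on UNIV f" "compact K" "\<And>x. x \<notin> K \<Longrightarrow> f x = 0"
  shows "integrable lborel f"
proof -
  obtain B where B: "\<And>x. norm (f x) \<le> B" using bounded_compact_support[OF assms] by metis
  show ?thesis
  proof (rule integrableI_bounded_set[where A = K and B = B])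
    show "f \<in> borel_measurable lborel" using borel_measurable_continuous_onI[OF assms(1)] by simp
    show "emeasure lborel K < \<infinity>" using assms(2) emeasure_compact_finite by auto
  qed (use assms B in \<open>auto simp: borel_compact\<close>)
qed

text \<open>The integral of a difference quotient vanishes by translation invariance.\<close>

lemma integral_frechet_derivative_eq_0:
  fixes F :: "'a::euclidean_space \<Rightarrow> real"
  assumes diff: "\<And>x. F differentiable (at x)"
    and cont: "continuous_on UNIV (\<lambda>x. frechet_derivative F (at x) e)"
    and K: "compact K" "\<And>x. x \<notin> K \<Longrightarrow> F x = 0"
  shows "(LINT x|lborel. frechet_derivative F (at x) e) = 0"
proof -
  define D where "D x = frechet_derivative F (at x) e" for x
  define s where "s n x = (F (x + inverse (real (Suc n)) *\<^sub>R e) - F x) / inverse (real (Suc n))" for n x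
  have contF: "continuous_on UNIV F"
    using diff by (simp add: continuous_at_imp_continuous_on differentiable_imp_continuous_within)
  have intF: "integrable lborel F" by (rule integrable_compact_support[OF contF K])
  have [measurable]: "F \<in> borel_measurable borel" using contF by (rule borel_measurable_continuous_onI)
  have D0: "D x = 0" if "x \<notin> K" for x
    unfolding D_def using K that by (intro frechet_derivative_outside_support) (auto simp: compact_imp_closed)
  obtain B where B: "0 \<le> B" "\<And>x. \<bar>D x\<bar> \<le> B"
    using bounded_compact_support[OF cont[folded D_def] K(1) D0] by (metis real_norm_def)
  obtain R where R: "\<And>x. x \<in> K \<Longrightarrow> norm x \<le> R"
    using compact_imp_bounded[OF K(1)] by (auto simp: bounded_iff)
  have der: "((\<lambda>s. F (x + s *\<^sub>R e)) has_real_derivative D (x + t *\<^sub>R e)) (at t)" for x t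
    unfolding D_def by (rule has_real_derivative_along_line[OF diff])
  have "(\<lambda>n. integral\<^sup>L lborel (s n)) \<longlonglongrightarrow> integral\<^sup>L lborel D"
  proof (rule integral_dominated_convergence)
    show "D \<in> borel_measurable lborel"
      using borel_measurable_continuous_onI[OF cont] by (simp add: D_def[abs_def])
    show "s n \<in> borel_measurable lborel" for n
      unfolding s_def[abs_def] by measurable
    \<comment> \<open>The steps of the quotients are at most 1, so each quotient vanishes outside
      the ball containing \<open>K\<close> enlarged by \<open>norm e\<close>. The mean value theorem
      bounds it by \<open>B\<close>.\<close>
    show "integrable lborel (\<lambda>x. B * indicator (cball 0 (R + norm e)) x)"
      using emeasure_compact_finite[of "cball 0 (R + norm e)"]
      by (intro integrable_mult_right) auto
    show "AE x in lborel. (\<lambda>n. s n x) \<longlonglongrightarrow> D x"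
    proof (rule AE_I2)
      fix x
      have "((\<lambda>h. (F (x + (0 + h) *\<^sub>R e) - F (x + 0 *\<^sub>R e)) / h) \<longlongrightarrow> D (x + 0 *\<^sub>R e)) (at 0)"
        using der[of x 0] by (simp add: DERIV_def)
      moreover have "filterlim (\<lambda>n. inverse (real (Suc n))) (at 0) sequentially"
        by (rule filterlim_atI[OF LIMSEQ_inverse_real_of_nat]) simp
      ultimately show "(\<lambda>n. s n x) \<longlonglongrightarrow> D x"
        unfolding s_def by (drule_tac filterlim_compose) auto
    qed
    show "AE x in lborel. norm (s n x) \<le> B * indicator (cball 0 (R + norm e)) x" for n
    proof (rule AE_I2)
      fix x
      let ?h = "inverse (real (Suc n))"
      have h: "0 < ?h" "?h \<le> 1" by (auto simp: divide_simps)
      show "norm (s n x) \<le> B * indicator (cball 0 (R + norm e)) x"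
      proof (cases "x \<in> cball 0 (R + norm e)")
        case True
        have "\<exists>z. 0 < z \<and> z < ?h \<and> F (x + ?h *\<^sub>R e) - F (x + 0 *\<^sub>R e) = (?h - 0) * D (x + z *\<^sub>R e)"
          by (rule MVT2[OF h(1)]) (rule der)
        then obtain z where "F (x + ?h *\<^sub>R e) - F x = ?h * D (x + z *\<^sub>R e)" by auto
        then have "s n x = D (x + z *\<^sub>R e)" unfolding s_def by simp
        then show ?thesis using B(2) True by simp
      next
        case False
        have "norm x \<le> norm (x + ?h *\<^sub>R e) + ?h * norm e"
          using norm_triangle_ineq4[of "x + ?h *\<^sub>R e" "?h *\<^sub>R e"] h by simp
        also have "?h * norm e \<le> norm e" using h by (simp add: mult_left_le_one_le)
        finally have "R < norm (x + ?h *\<^sub>R e)" using False by simp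
        moreover have "R + norm e < norm x" using False by simp
        then have "R < norm x" using norm_ge_zero[of e] by linarith
        ultimately have "F (x + ?h *\<^sub>R e) = 0" "F x = 0"
          using R K(2) by (meson not_le)+
        then show ?thesis using False unfolding s_def by simp
      qed
    qed
  qed
  moreover have "integral\<^sup>L lborel (s n) = 0" for n
  proof -
    let ?c = "inverse (real (Suc n)) *\<^sub>R e"
    have "integrable (distr lborel borel ((+) ?c)) F" using intF by (simp add: lborel_distr_plus)
    then have int: "integrable lborel (\<lambda>x. F (?c + x))"
      by (subst (asm) integrable_distr_eq) auto
    have "integral\<^sup>L lborel F = integral\<^sup>L (distr lborel borel ((+) ?c)) F"
      by (simp add: lborel_distr_plus)
    also have "\<dots> = (LINT x|lborel. F (?c + x))"
      by (rule integral_distr) auto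
    finally have eq: "(LINT x|lborel. F (?c + x)) = integral\<^sup>L lborel F" by simp
    have "integral\<^sup>L lborel (s n) = (LINT x|lborel. (F (?c + x) - F x) / inverse (real (Suc n)))"
      unfolding s_def by (simp only: add.commute)
    also have "\<dots> = (LINT x|lborel. F (?c + x) - F x) / inverse (real (Suc n))"
      by (rule integral_divide_zero)
    also have "(LINT x|lborel. F (?c + x) - F x) = 0"
      by (subst Bochner_Integration.integral_diff[OF int intF]) (simp only: eq diff_self)
    finally show ?thesis by (simp only: div_0)
  qed
  ultimately have "integral\<^sup>L lborel D = 0" by (simp add: LIMSEQ_const_iff)
  then show ?thesis by (simp only: D_def[abs_def])
qed

text \<open>The product of two test functions has compact support, so its partial derivatives
  integrate to 0. This lets test functions serve as elements of H^1 when orthogonality to gradients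
  is turned into zero divergence.\<close>

lemma weak_grad_test_function:
  assumes G: "open G" "bounded G" and \<phi>: "test_function G \<phi>"
  shows "weak_grad G \<phi> (grad \<phi>)"
  unfolding weak_grad_def
proof (intro conjI allI impI)
  show "\<phi> \<in> L2 G" using assms by (rule test_function_L2)
  have s\<phi>: "smooth_on UNIV \<phi>" using \<phi> by (simp add: test_function_def)
  show "grad \<phi> \<in> L2 G" by (intro L2_continuous continuous_on_grad s\<phi> G)
  fix \<psi> :: "real^3 \<Rightarrow> real" and i :: 3
  assume \<psi>: "test_function G \<psi>"
  then have s\<psi>: "smooth_on UNIV \<psi>" by (simp add: test_function_def)
  obtain K where K: "compact K" "K \<subseteq> G" "\<And>x. x \<notin> K \<Longrightarrow> \<phi> x = 0"
    using \<phi> by (auto simp: test_function_def)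
  let ?F = "\<lambda>x. \<phi> x * \<psi> x" and ?e = "axis i (1::real)"
  note d\<phi> = smooth_on_UNIV_D(1)[OF s\<phi>] and d\<psi> = smooth_on_UNIV_D(1)[OF s\<psi>]
  have D: "frechet_derivative ?F (at x) ?e = \<phi> x * partial_deriv i \<psi> x + partial_deriv i \<phi> x * \<psi> x" for x
  proof -
    have "(?F has_derivative (\<lambda>h. \<phi> x * frechet_derivative \<psi> (at x) h + frechet_derivative \<phi> (at x) h * \<psi> x)) (at x)"
      by (intro has_derivative_mult d\<phi>[unfolded frechet_derivative_works] d\<psi>[unfolded frechet_derivative_works])
    from frechet_derivative_at[OF this, symmetric] show ?thesis by (simp add: partial_deriv_def)
  qed
  have p\<phi>: "partial_deriv i \<phi> x = 0" if "x \<notin> K" for x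
    unfolding partial_deriv_def using K that
    by (intro frechet_derivative_outside_support[of K]) (auto simp: compact_imp_closed)
  have contD: "continuous_on UNIV (\<lambda>x. frechet_derivative ?F (at x) ?e)"
    unfolding D by (intro continuous_on_add continuous_on_mult continuous_on_partial_deriv s\<phi> s\<psi> smooth_on_UNIV_D(2))
  have "(LINT x|lborel. frechet_derivative ?F (at x) ?e) = 0"
  proof (rule integral_frechet_derivative_eq_0[OF _ contD K(1)])
    show "?F differentiable (at x)" for x by (intro differentiable_mult d\<phi> d\<psi>)
  qed (simp add: K(3))
  moreover have "(LINT x|lborel. frechet_derivative ?F (at x) ?e) = (LINT x|lebesgue. frechet_derivative ?F (at x) ?e)"
    using borel_measurable_continuous_onI[OF contD] by (intro integral_completion[symmetric]) simp
  moreover have "\<dots> = (LINT x|lebesgue_on G. frechet_derivative ?F (at x) ?e)"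
  proof -
    \<comment> \<open>Outside \<open>K\<close>, hence outside \<open>G\<close>, both terms of the
      product rule vanish, so the integral over the whole space is the integral over
      \<open>G\<close>.\<close>
    have "(\<lambda>x. indicator G x *\<^sub>R frechet_derivative ?F (at x) ?e) = (\<lambda>x. frechet_derivative ?F (at x) ?e)"
    proof
      fix x show "indicator G x *\<^sub>R frechet_derivative ?F (at x) ?e = frechet_derivative ?F (at x) ?e"
        using K(2) K(3)[of x] p\<phi>[of x] by (cases "x \<in> K") (auto simp: D)
    qed
    then show ?thesis using G by (subst integral_restrict_space) simp_all
  qed
  ultimately have "(LINT x|lebesgue_on G. \<phi> x * partial_deriv i \<psi> x + partial_deriv i \<phi> x * \<psi> x) = 0"
    by (simp add: D)
  moreover have "integrable (lebesgue_on G) (\<lambda>x. \<phi> x * partial_deriv i \<psi> x)"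
    using integrable_L2_inner[OF \<open>\<phi> \<in> L2 G\<close> L2_continuous[OF continuous_on_partial_deriv[OF s\<psi>] G]] by simp
  moreover have "integrable (lebesgue_on G) (\<lambda>x. partial_deriv i \<phi> x * \<psi> x)"
    using integrable_L2_inner[OF L2_continuous[OF continuous_on_partial_deriv[OF s\<phi>] G] test_function_L2[OF G \<psi>]] by simp
  ultimately show "L2_inner G \<phi> (partial_deriv i \<psi>) = - L2_inner G (\<lambda>x. grad \<phi> x $ i) \<psi>"
    by (simp add: L2_inner_def grad_def Bochner_Integration.integral_add)
qed

section \<open>The fundamental lemma of the calculus of variations\<close>

text \<open>Derivatives of \<open>exp (- inverse t)\<close>, cut off at \<open>t \<le> 0\<close>, stay in the family
  of functions \<open>poly p (inverse t) * exp (- inverse t)\<close>.\<close>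

definition flat_exp :: "real poly \<Rightarrow> real \<Rightarrow> real" where
  "flat_exp p t = (if t > 0 then poly p (inverse t) * exp (- inverse t) else 0)"

lemma tendsto_poly_div_exp_0:
  fixes p :: "real poly"
  shows "((\<lambda>x. poly p x * exp (- x)) \<longlongrightarrow> 0) at_top"
proof -
  have "((\<lambda>x. \<Sum>i\<le>degree p. coeff p i * (x ^ i / exp x)) \<longlongrightarrow> (\<Sum>i\<le>degree p. coeff p i * 0)) at_top"
    by (intro tendsto_intros tendsto_power_div_exp_0)
  moreover have "(\<lambda>x. poly p x * exp (- x)) = (\<lambda>x. \<Sum>i\<le>degree p. coeff p i * (x ^ i / exp x))"
    by (simp add: fun_eq_iff poly_altdef sum_distrib_right exp_minus divide_inverse mult.assoc)
  ultimately show ?thesis by simp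
qed

text \<open>With s = 1/t, so ds/dt = -s^2, the derivative of p(s) exp(-s) is s^2 (p(s) - p'(s))
  exp(-s); the polynomial \<open>[:0, 0, 1:]\<close> is the factor s^2. At t = 0 the exponential
  beats every power of s.\<close>

lemma has_real_derivative_flat_exp:
  "(flat_exp p has_real_derivative flat_exp ([:0, 0, 1:] * (p - pderiv p)) t) (at t)"
proof -
  consider "t < 0" | "t = 0" | "t > 0" by linarith
  then show ?thesis
  proof cases
    case 1
    have "(flat_exp p has_real_derivative 0) (at t)"
      by (rule has_field_derivative_transform_within_open[of "\<lambda>_. 0" 0 t "{..<0}"])
        (use 1 in \<open>auto simp: flat_exp_def\<close>)
    then show ?thesis using 1 by (simp add: flat_exp_def)
  next
    case 2
    have "((\<lambda>h. flat_exp p h / h) \<longlongrightarrow> 0) (at 0)"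
    proof (rule filterlim_split_at)
      have "\<forall>\<^sub>F h in at_left (0::real). 0 = flat_exp p h / h"
        by (simp add: eventually_at_filter flat_exp_def)
      then show "((\<lambda>h. flat_exp p h / h) \<longlongrightarrow> 0) (at_left 0)"
        by (rule Lim_transform_eventually[OF tendsto_const])
      \<comment> \<open>The extra factor 1/h of the difference quotient is absorbed by multiplying
        \<open>p\<close> by the variable, which is \<open>pCons 0 p\<close>.\<close>
      have "((\<lambda>h. poly (pCons 0 p) (inverse h) * exp (- inverse h)) \<longlongrightarrow> 0) (at_right (0::real))"
        by (rule filterlim_compose[OF tendsto_poly_div_exp_0 filterlim_inverse_at_top_right])
      moreover have "\<forall>\<^sub>F h in at_right (0::real). poly (pCons 0 p) (inverse h) * exp (- inverse h) = flat_exp p h / h"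
        by (simp add: eventually_at_filter flat_exp_def divide_inverse mult_ac)
      ultimately show "((\<lambda>h. flat_exp p h / h) \<longlongrightarrow> 0) (at_right 0)"
        by (rule Lim_transform_eventually)
    qed
    then show ?thesis using 2 by (simp add: DERIV_def flat_exp_def)
  next
    case 3
    have "((\<lambda>t. poly p (inverse t) * exp (- inverse t)) has_real_derivative
        flat_exp ([:0, 0, 1:] * (p - pderiv p)) t) (at t)"
      using 3 by (auto intro!: derivative_eq_intros poly_DERIV[THEN DERIV_chain2]
          simp: flat_exp_def algebra_simps power2_eq_square divide_inverse)
    then show ?thesis
      by (rule has_field_derivative_transform_within_open[of _ _ _ "{0<..}"])
        (use 3 in \<open>auto simp: flat_exp_def\<close>)
  qed
qed

section \<open>Closure of \<open>C_k_on\<close> under the operations that build bump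
  functions\<close>

lemma C_k_on_UNIV_SucI:
  assumes "\<And>x. (f has_derivative f' x) (at x)" "\<And>b. b \<in> Basis \<Longrightarrow> C_k_on k UNIV (\<lambda>x. f' x b)"
  shows "C_k_on (Suc k) UNIV f"
proof -
  have "frechet_derivative f (at x) = f' x" for x
    using frechet_derivative_at[OF assms(1)[of x]] by simp
  then show ?thesis using assms unfolding C_k_on.simps differentiable_def by auto
qed

lemma C_k_on_UNIV_SucD:
  assumes "C_k_on (Suc k) UNIV f"
  shows "(f has_derivative frechet_derivative f (at x)) (at x)"
    and "b \<in> Basis \<Longrightarrow> C_k_on k UNIV (\<lambda>x. frechet_derivative f (at x) b)"
  using assms by (auto simp: frechet_derivative_works)

text \<open>The product rule leaves one factor undifferentiated; in the induction for products this
  factor is needed at the lower order.\<close>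

lemma C_k_on_UNIV_mono: "C_k_on (Suc k) UNIV f \<Longrightarrow> C_k_on k UNIV f"
proof (induction k arbitrary: f)
  case 0
  then show ?case
    by (auto intro!: continuous_at_imp_continuous_on differentiable_imp_continuous_within)
next
  case (Suc k)
  then show ?case using C_k_on.simps(2) by blast
qed

lemma C_k_on_const: "C_k_on k UNIV (\<lambda>x. c)"
proof (induction k arbitrary: c)
  case (Suc k)
  show ?case by (rule C_k_on_UNIV_SucI[OF has_derivative_const Suc.IH])
qed simp

lemma C_k_on_add:
  "C_k_on k UNIV f \<Longrightarrow> C_k_on k UNIV g \<Longrightarrow> C_k_on k UNIV (\<lambda>x. f x + g x)"
proof (induction k arbitrary: f g)
  case 0
  then show ?case by (simp add: continuous_on_add)
next
  case (Suc k)
  note f = C_k_on_UNIV_SucD[OF Suc.prems(1)] and g = C_k_on_UNIV_SucD[OF Suc.prems(2)]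
  show ?case
    by (rule C_k_on_UNIV_SucI[OF has_derivative_add[OF f(1) g(1)]]) (rule Suc.IH[OF f(2) g(2)])
qed

lemma C_k_on_mult:
  fixes f g :: "'a::euclidean_space \<Rightarrow> real"
  shows "C_k_on k UNIV f \<Longrightarrow> C_k_on k UNIV g \<Longrightarrow> C_k_on k UNIV (\<lambda>x. f x * g x)"
proof (induction k arbitrary: f g)
  case 0
  then show ?case by (simp add: continuous_on_mult)
next
  case (Suc k)
  note f = C_k_on_UNIV_SucD[OF Suc.prems(1)] and g = C_k_on_UNIV_SucD[OF Suc.prems(2)]
  show ?case
    by (rule C_k_on_UNIV_SucI[OF has_derivative_mult[OF f(1) g(1)]])
      (intro C_k_on_add Suc.IH f(2) g(2) C_k_on_UNIV_mono[OF Suc.prems(1)] C_k_on_UNIV_mono[OF Suc.prems(2)])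
qed

lemma C_k_on_prod:
  fixes f :: "'i \<Rightarrow> 'a::euclidean_space \<Rightarrow> real"
  assumes "\<And>i. i \<in> I \<Longrightarrow> C_k_on k UNIV (f i)"
  shows "C_k_on k UNIV (\<lambda>x. \<Prod>i\<in>I. f i x)"
  using assms
  by (induction I rule: infinite_finite_induct) (auto intro: C_k_on_mult C_k_on_const)

lemma C_k_on_scaleR_const:
  fixes f :: "'a::euclidean_space \<Rightarrow> real"
  shows "C_k_on k UNIV f \<Longrightarrow> C_k_on k UNIV (\<lambda>x. f x *\<^sub>R c)"
proof (induction k arbitrary: f)
  case 0
  then show ?case by (simp add: continuous_on_scaleR)
next
  case (Suc k)
  note f = C_k_on_UNIV_SucD[OF Suc.prems]
  show ?case
    by (rule C_k_on_UNIV_SucI[OF has_derivative_scaleR_left[OF f(1)]]) (rule Suc.IH[OF f(2)])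
qed

text \<open>The factor \<open>a\<close> and the polynomial \<open>p\<close> vary in the induction: a
  directional derivative along b has the same form, with \<open>a * (b \<bullet> e)\<close> in place
  of \<open>a\<close> and a new polynomial.\<close>

lemma C_k_on_flat_exp:
  fixes e :: "'a::euclidean_space"
  shows "C_k_on k UNIV (\<lambda>x. a * flat_exp p (x \<bullet> e + d))"
proof (induction k arbitrary: a p)
  case 0
  have "continuous_on UNIV (flat_exp p)"
    using DERIV_isCont[OF has_real_derivative_flat_exp] by (simp add: continuous_at_imp_continuous_on)
  then have "continuous_on UNIV (\<lambda>x. flat_exp p (x \<bullet> e + d))"
    by (rule continuous_on_compose2) (auto intro!: continuous_intros)
  then show ?case by (simp add: continuous_on_mult_left)
next
  case (Suc k)
  let ?q = "[:0, 0, 1:] * (p - pderiv p)"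
  have d: "((\<lambda>x. a * flat_exp p (x \<bullet> e + d)) has_derivative
      (\<lambda>h. a * (h \<bullet> e) * flat_exp ?q (x \<bullet> e + d))) (at x)" for x
  proof -
    have "((\<lambda>x. x \<bullet> e + d) has_derivative (\<lambda>h. h \<bullet> e)) (at x)"
      by (auto intro!: derivative_eq_intros)
    from has_derivative_mult_right[OF has_derivative_compose[OF this has_real_derivative_flat_exp[unfolded has_field_derivative_def]], of a]
    show ?thesis by (simp add: mult_ac)
  qed
  show ?case by (rule C_k_on_UNIV_SucI[OF d Suc.IH])
qed

text \<open>One factor exp(-1/t) for each face of the box, where t is \<open>c\<close> times the
  distance to the hyperplane of that face. For growing \<open>c\<close> every factor tends to 1
  inside the box, so the bumps approximate the indicator of the open box while vanishing outside
  it.\<close>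

definition box_bump :: "'a::euclidean_space \<Rightarrow> 'a \<Rightarrow> real \<Rightarrow> 'a \<Rightarrow> real" where
  "box_bump a b c x = (\<Prod>e\<in>Basis. flat_exp 1 (c * ((x - a) \<bullet> e)) * flat_exp 1 (c * ((b - x) \<bullet> e)))"

lemma smooth_on_box_bump: "smooth_on UNIV (\<lambda>x. box_bump a b c x *\<^sub>R v)"
  unfolding smooth_on_def
proof
  fix k
  have 1: "C_k_on k UNIV (\<lambda>x. flat_exp 1 (c * ((x - a) \<bullet> e)))" for e :: 'a
    using C_k_on_flat_exp[of k 1 1 "c *\<^sub>R e" "- (c * (a \<bullet> e))"] by (simp add: algebra_simps)
  have 2: "C_k_on k UNIV (\<lambda>x. flat_exp 1 (c * ((b - x) \<bullet> e)))" for e :: 'a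
    using C_k_on_flat_exp[of k 1 1 "- c *\<^sub>R e" "c * (b \<bullet> e)"] by (simp add: algebra_simps)
  show "C_k_on k UNIV (\<lambda>x. box_bump a b c x *\<^sub>R v)"
    unfolding box_bump_def by (intro C_k_on_scaleR_const C_k_on_prod C_k_on_mult 1 2)
qed

lemma box_bump_eq_0:
  assumes "0 < c" "x \<notin> box a b"
  shows "box_bump a b c x = 0"
proof -
  obtain e where "e \<in> Basis" "x \<bullet> e \<le> a \<bullet> e \<or> b \<bullet> e \<le> x \<bullet> e"
    using assms(2) by (auto simp: mem_box not_less)
  then show ?thesis unfolding box_bump_def using assms(1)
    by (intro prod_zero bexI[of _ e])
      (auto simp: flat_exp_def inner_diff_left zero_less_mult_iff)
qed

lemma box_bump_bounds: "0 \<le> box_bump a b c x" "box_bump a b c x \<le> 1"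
proof -
  have "0 \<le> flat_exp 1 t" "flat_exp 1 t \<le> 1" for t by (auto simp: flat_exp_def)
  then show "0 \<le> box_bump a b c x" "box_bump a b c x \<le> 1"
    unfolding box_bump_def by (auto intro!: prod_nonneg prod_le_1 mult_le_one)
qed

lemma box_bump_tendsto_indicator:
  "(\<lambda>n. box_bump a b (real (Suc n)) x) \<longlonglongrightarrow> indicator (box a b) x"
proof (cases "x \<in> box a b")
  case True
  have *: "(\<lambda>n. flat_exp 1 (real (Suc n) * t)) \<longlonglongrightarrow> 1" if "0 < t" for t
  proof -
    have "(\<lambda>n. exp (- (inverse (real (Suc n)) * inverse t))) \<longlonglongrightarrow> exp (- (0 * inverse t))"
      by (intro tendsto_intros LIMSEQ_inverse_real_of_nat)
    moreover have "flat_exp 1 (real (Suc n) * t) = exp (- (inverse (real (Suc n)) * inverse t))" for n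
      using that by (simp add: flat_exp_def zero_less_mult_iff del: of_nat_Suc)
    ultimately show ?thesis by simp
  qed
  have "(\<lambda>n. box_bump a b (real (Suc n)) x) \<longlonglongrightarrow> (\<Prod>e\<in>(Basis::'a set). 1 * 1)"
    unfolding box_bump_def using True
    by (intro tendsto_prod tendsto_mult *) (auto simp: mem_box inner_diff_left)
  then show ?thesis using True by simp
next
  case False
  then show ?thesis by (simp add: box_bump_eq_0)
qed

lemma test_function_box_bump:
  assumes "cbox a b \<subseteq> G" "0 < c"
  shows "test_function G (\<lambda>x. box_bump a b c x *\<^sub>R v)"
proof -
  have "box_bump a b c x = 0" if "x \<notin> cbox a b" for x
    using that box_subset_cbox[of a b] by (intro box_bump_eq_0 assms) auto
  then show ?thesis using assms unfolding test_function_def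
    by (auto simp: smooth_on_box_bump intro!: exI[of _ "cbox a b"])
qed

text \<open>The Henstock lemma in place of a differentiation theorem: it makes the sum of |vol(k)
  f(x) - integral over k| small for fine divisions. With vanishing integrals this sum is the Riemann
  sum of |f|, so |f| has integral 0.\<close>

lemma negligible_if_box_integrals_0:
  fixes f :: "'a::euclidean_space \<Rightarrow> real"
  assumes int: "f integrable_on cbox a b"
    and 0: "\<And>c d. cbox c d \<subseteq> cbox a b \<Longrightarrow> integral (cbox c d) f = 0"
  shows "negligible {x \<in> cbox a b. f x \<noteq> 0}"
proof -
  have has: "((\<lambda>x. \<bar>f x\<bar>) has_integral 0) (cbox a b)"
    unfolding has_integral
  proof (intro allI impI)
    fix e :: real assume "0 < e"
    obtain \<gamma> where \<gamma>: "gauge \<gamma>"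
      "\<And>p. p tagged_partial_division_of cbox a b \<Longrightarrow> \<gamma> fine p \<Longrightarrow>
         (\<Sum>(x,k)\<in>p. norm (measure lborel k *\<^sub>R f x - integral k f)) < e"
      by (rule Henstock_lemma[OF int \<open>0 < e\<close>]) (rule that)
    have "norm ((\<Sum>(x,k)\<in>p. measure lborel k *\<^sub>R \<bar>f x\<bar>) - 0) < e"
      if p: "p tagged_division_of cbox a b" "\<gamma> fine p" for p
    proof -
      have "(\<Sum>(x,k)\<in>p. measure lborel k *\<^sub>R \<bar>f x\<bar>) = (\<Sum>(x,k)\<in>p. norm (measure lborel k *\<^sub>R f x - integral k f))"
      proof (rule sum.cong[OF refl], clarify)
        fix x k assume xk: "(x, k) \<in> p"
        obtain c d where "k = cbox c d" using tagged_division_ofD(4)[OF p(1) xk] by blast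
        then have "integral k f = 0" using tagged_division_ofD(3)[OF p(1) xk] 0 by simp
        then show "measure lborel k *\<^sub>R \<bar>f x\<bar> = norm (measure lborel k *\<^sub>R f x - integral k f)"
          by (simp add: abs_mult)
      qed
      also have "\<dots> < e"
        using p by (intro \<gamma>(2)) (auto simp: tagged_division_of_def)
      finally have "(\<Sum>(x,k)\<in>p. measure lborel k *\<^sub>R \<bar>f x\<bar>) < e" .
      moreover have "0 \<le> (\<Sum>(x,k)\<in>p. measure lborel k *\<^sub>R \<bar>f x\<bar>)"
        by (intro sum_nonneg) auto
      ultimately show ?thesis by simp
    qed
    then show "\<exists>\<gamma>. gauge \<gamma> \<and> (\<forall>p. p tagged_division_of cbox a b \<and> \<gamma> fine p \<longrightarrow>
        norm ((\<Sum>(x,k)\<in>p. measure lborel k *\<^sub>R \<bar>f x\<bar>) - 0) < e)"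
      using \<gamma>(1) by blast
  qed
  then have abs: "(\<lambda>x. \<bar>f x\<bar>) absolutely_integrable_on cbox a b"
    by (intro nonnegative_absolutely_integrable_1) auto
  then have ab2: "integrable lebesgue (\<lambda>x. indicator (cbox a b) x *\<^sub>R \<bar>f x\<bar>)"
    by (simp add: set_integrable_def)
  have "(LINT x|lebesgue. indicator (cbox a b) x *\<^sub>R \<bar>f x\<bar>) = 0"
    using set_lebesgue_integral_eq_integral(2)[OF abs] integral_unique[OF has]
    by (simp add: set_lebesgue_integral_def)
  then have "AE x in lebesgue. indicator (cbox a b) x *\<^sub>R \<bar>f x\<bar> = 0"
    by (subst (asm) integral_nonneg_eq_0_iff_AE[OF ab2]) auto
  then have "negligible {x. indicator (cbox a b) x *\<^sub>R \<bar>f x\<bar> \<noteq> 0}"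
    by (simp only: eventually_ae_filter_negligible not_not mem_Collect_eq) (auto intro: negligible_subset)
  then show ?thesis by (rule negligible_subset) auto
qed

text \<open>Bumps approximating box indicators turn orthogonality into vanishing integrals over all
  closed boxes in \<open>G\<close>, by dominated convergence; then
  \<open>negligible_if_box_integrals_0\<close> applies.\<close>

lemma L2_orthogonal_test_functions:
  fixes g :: "'a::euclidean_space \<Rightarrow> 'b::euclidean_space"
  assumes G: "open G" "bounded G" and g: "g \<in> L2 G"
    and orth: "\<And>\<phi>. test_function G \<phi> \<Longrightarrow> L2_inner G g \<phi> = 0"
  shows "AE x in lebesgue_on G. g x = 0"
proof -
  have Gl: "G \<in> sets lebesgue" "G \<in> lmeasurable" using G by (auto intro: lmeasurable_open)
  \<comment> \<open>Pairing g with the test field \<open>box_bump\<close> times the constant vector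
    \<open>v\<close> integrates the bump against this scalar component.\<close>
  define h where "h v x = g x \<bullet> v" for v x
  have int_h: "integrable (lebesgue_on G) (h v)" for v
    using integrable_L2_inner[OF g L2_const[OF Gl(2)]] unfolding h_def[abs_def] .
  then have h_on: "h v absolutely_integrable_on G" for v
    using Gl by (simp add: set_integrable_def integrable_restrict_space)
  have box0: "integral (cbox a b) (h v) = 0" if ab: "cbox a b \<subseteq> G" for a b v
  proof -
    have "(\<lambda>n. LINT x|lebesgue_on G. box_bump a b (real (Suc n)) x * h v x)
      \<longlonglongrightarrow> (LINT x|lebesgue_on G. indicator (box a b) x * h v x)"
    proof (rule integral_dominated_convergence)
      show "integrable (lebesgue_on G) (\<lambda>x. \<bar>h v x\<bar>)" using int_h by simp
      show hm: "(\<lambda>x. indicator (box a b) x * h v x) \<in> borel_measurable (lebesgue_on G)"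
        using int_h[of v] ab box_subset_cbox[of a b] Gl
        by (intro borel_measurable_times borel_measurable_indicator borel_measurable_integrable)
          (auto simp: sets_restrict_space_iff)
      show "(\<lambda>x. box_bump a b (real (Suc n)) x * h v x) \<in> borel_measurable (lebesgue_on G)" for n
        using int_h[of v] smooth_on_UNIV_D(2)[OF smooth_on_box_bump[of a b "real (Suc n)" "1::real"]] Gl
        by (intro borel_measurable_times continuous_imp_measurable_on_sets_lebesgue borel_measurable_integrable)
          (auto intro: continuous_on_subset)
      show "AE x in lebesgue_on G. (\<lambda>n. box_bump a b (real (Suc n)) x * h v x) \<longlonglongrightarrow> indicator (box a b) x * h v x"
        by (intro AE_I2 tendsto_mult tendsto_const box_bump_tendsto_indicator)
      show "AE x in lebesgue_on G. norm (box_bump a b (real (Suc n)) x * h v x) \<le> \<bar>h v x\<bar>" for n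
        using box_bump_bounds[of a b "real (Suc n)"]
        by (intro AE_I2) (simp add: abs_mult mult_left_le_one_le)
    qed
    moreover have "(LINT x|lebesgue_on G. box_bump a b (real (Suc n)) x * h v x) = 0" for n
      using orth[OF test_function_box_bump[OF ab, of "real (Suc n)" v]]
      by (simp add: L2_inner_def h_def)
    ultimately have "(LINT x|lebesgue_on G. indicator (box a b) x * h v x) = 0"
      by (simp add: LIMSEQ_const_iff)
    moreover have "(LINT x|lebesgue_on G. indicator (box a b) x * h v x) = integral (box a b) (h v)"
    proof -
      have "box a b \<subseteq> G" using ab box_subset_cbox by blast
      then have "h v absolutely_integrable_on box a b"
        using h_on[of v] by (rule set_integrable_subset[rotated 2]) simp
      moreover have "(\<lambda>x. indicator G x *\<^sub>R (indicator (box a b) x * h v x)) = (\<lambda>x. indicator (box a b) x *\<^sub>R h v x)"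
        using \<open>box a b \<subseteq> G\<close> by (auto simp: indicator_def fun_eq_iff)
      ultimately show ?thesis
        using Gl set_lebesgue_integral_eq_integral(2)[of "box a b" "h v"]
        by (simp add: integral_restrict_space set_lebesgue_integral_def)
    qed
    ultimately show ?thesis by (simp add: integral_open_interval)
  qed
  have neg: "negligible {x \<in> cbox a b. h v x \<noteq> 0}" if ab: "cbox a b \<subseteq> G" for a b v
  proof (rule negligible_if_box_integrals_0)
    show "h v integrable_on cbox a b"
      using h_on ab by (intro integrable_on_subcbox[of "h v" G] set_lebesgue_integral_eq_integral(1)) auto
  qed (use box0 ab in blast)
  \<comment> \<open>Vanishing almost everywhere is known only inside closed boxes contained in
    \<open>G\<close>; a countable cover by such boxes globalises it.\<close>
  obtain D where D: "countable D" "D \<subseteq> Pow G" "\<And>X. X \<in> D \<Longrightarrow> \<exists>a b. X = cbox a b" "\<Union>D = G"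
    by (rule open_countable_Union_open_cbox[OF G(1)]) (rule that)
  have "negligible (\<Union>X\<in>D. \<Union>v\<in>Basis. {x \<in> X. h v x \<noteq> 0})"
  proof (intro negligible_countable_Union countable_image D(1))
    fix Y assume "Y \<in> (\<lambda>X. \<Union>v\<in>Basis. {x \<in> X. h v x \<noteq> 0}) ` D"
    then obtain X where X: "X \<in> D" "Y = (\<Union>v\<in>Basis. {x \<in> X. h v x \<noteq> 0})" by blast
    obtain a b where "X = cbox a b" using D(3)[OF X(1)] by blast
    then show "negligible Y"
      using neg[of a b] D(2) X by (auto intro!: negligible_Union)
  qed
  moreover have "{x \<in> G. g x \<noteq> 0} \<subseteq> (\<Union>X\<in>D. \<Union>v\<in>Basis. {x \<in> X. h v x \<noteq> 0})"
  proof
    fix x assume x: "x \<in> {x \<in> G. g x \<noteq> 0}"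
    then obtain v where "v \<in> Basis" "g x \<bullet> v \<noteq> 0" using euclidean_all_zero_iff[of "g x"] by auto
    moreover obtain X where "X \<in> D" "x \<in> X" using x D(4) by blast
    ultimately show "x \<in> (\<Union>X\<in>D. \<Union>v\<in>Basis. {x \<in> X. h v x \<noteq> 0})" by (auto simp: h_def)
  qed
  ultimately have n: "negligible {x \<in> G. g x \<noteq> 0}" by (rule negligible_subset)
  have "AE x in lebesgue. x \<in> G \<longrightarrow> g x = 0"
    using n unfolding eventually_ae_filter_negligible by (intro exI[of _ "{x \<in> G. g x \<noteq> 0}"]) auto
  then show ?thesis using Gl by (simp add: AE_restrict_space_iff)
qed

section \<open>The weak rotor\<close>

lemma L2_curl_test_function:
  assumes "open G" "bounded G" "test_function G \<phi>"
  shows "curl \<phi> \<in> L2 G"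
  using assms by (intro L2_continuous continuous_on_curl) (auto simp: test_function_def)

lemma weak_rot_L2:
  assumes "weak_rot G f g"
  shows "f \<in> L2 G" "g \<in> L2 G"
  using assms by (simp_all add: weak_rot_def)

lemma weak_rot_D: "weak_rot G f g \<Longrightarrow> test_function G \<phi> \<Longrightarrow> L2_inner G f (curl \<phi>) = L2_inner G g \<phi>"
  by (simp add: weak_rot_def)

text \<open>The choice made by \<open>rot\<close> means something only once a weak rotor is known to
  exist; this is how \<open>rot G f\<close> enters an argument.\<close>

lemma weak_rot_rot: "weak_rot G f g \<Longrightarrow> weak_rot G f (rot G f)"
  unfolding rot_def by (rule someI[of "weak_rot G f"])

lemma weak_rot_scaleR: "weak_rot G f g \<Longrightarrow> weak_rot G (\<lambda>x. c *\<^sub>R f x) (\<lambda>x. c *\<^sub>R g x)"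
  unfolding weak_rot_def by (simp add: L2_scaleR L2_inner_scaleR_left)

lemma weak_rot_add:
  assumes "open G" "bounded G" "weak_rot G f g" "weak_rot G f' g'"
  shows "weak_rot G (\<lambda>x. f x + f' x) (\<lambda>x. g x + g' x)"
  using assms unfolding weak_rot_def
  by (simp add: L2_add L2_inner_add_left L2_curl_test_function test_function_L2)

lemma weak_rot_diff:
  assumes "open G" "bounded G" "weak_rot G f g" "weak_rot G f' g'"
  shows "weak_rot G (\<lambda>x. f x - f' x) (\<lambda>x. g x - g' x)"
  using weak_rot_add[OF assms(1-3) weak_rot_scaleR[OF assms(4), of "-1"]] by simp

lemma weak_rot_sum:
  assumes "open G" "bounded G" "\<And>j. j \<in> J \<Longrightarrow> weak_rot G (f j) (g j)"
  shows "weak_rot G (\<lambda>x. \<Sum>j\<in>J. f j x) (\<lambda>x. \<Sum>j\<in>J. g j x)"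
  using assms(3)
proof (induction J rule: infinite_finite_induct)
  case (insert i J)
  then show ?case using weak_rot_add[OF assms(1,2), of "f i" "g i"] by simp
qed (simp_all add: weak_rot_def L2_zero L2_inner_zero_left)

text \<open>Both defining integrals ignore null sets. Needed because an iterated rotor is an
  arbitrary representative of its class.\<close>

lemma weak_rot_cong:
  assumes G: "open G" "bounded G" and fg: "weak_rot G f g"
    and f': "f' \<in> L2 G" "L2_eq G f f'" and g': "g' \<in> L2 G" "L2_eq G g g'"
  shows "weak_rot G f' g'"
  unfolding weak_rot_def
proof (intro conjI allI impI)
  fix \<phi> :: "real^3 \<Rightarrow> real^3" assume \<phi>: "test_function G \<phi>"
  have "L2_inner G f' (curl \<phi>) = L2_inner G f (curl \<phi>)"
    by (rule L2_inner_cong_AE)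
      (intro L2_measurable f' weak_rot_L2[OF fg] L2_curl_test_function[OF G \<phi>] L2_eq_refl L2_eq_sym[OF f'(2)])+
  also have "\<dots> = L2_inner G g \<phi>" using fg \<phi> by (rule weak_rot_D)
  also have "\<dots> = L2_inner G g' \<phi>"
    by (rule L2_inner_cong_AE)
      (intro L2_measurable g' weak_rot_L2[OF fg] test_function_L2[OF G \<phi>] L2_eq_refl)+
  finally show "L2_inner G f' (curl \<phi>) = L2_inner G g' \<phi>" .
qed (use f' g' in simp_all)

text \<open>The difference of the two rotors is orthogonal to all test fields, so the fundamental
  lemma applies.\<close>

lemma weak_rot_unique:
  assumes G: "open G" "bounded G" and "weak_rot G f g" "weak_rot G f g'"
  shows "L2_eq G g g'"
proof -
  have g: "g \<in> L2 G" "g' \<in> L2 G" using assms by (auto simp: weak_rot_def)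
  have "AE x in lebesgue_on G. g x - g' x = 0"
  proof (rule L2_orthogonal_test_functions[OF G L2_diff[OF g]])
    fix \<phi> :: "real^3 \<Rightarrow> real^3" assume \<phi>: "test_function G \<phi>"
    show "L2_inner G (\<lambda>x. g x - g' x) \<phi> = 0"
      using weak_rot_D[OF assms(3) \<phi>] weak_rot_D[OF assms(4) \<phi>]
      by (simp add: L2_inner_diff_left[OF g test_function_L2[OF G \<phi>]])
  qed
  then show ?thesis by (simp add: L2_eq_def)
qed

text \<open>For a fixed test field both sides of the defining identity are continuous in the
  \<open>L2\<close> norm. This closedness justifies taking rotors of series term by term.\<close>

lemma weak_rot_limit:
  assumes G: "open G" "bounded G" and fg: "\<And>n. weak_rot G (F n) (H n)"
    and f: "f \<in> L2 G" "(\<lambda>n. L2_norm G (\<lambda>x. f x - F n x)) \<longlonglongrightarrow> 0"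
    and h: "h \<in> L2 G" "(\<lambda>n. L2_norm G (\<lambda>x. h x - H n x)) \<longlonglongrightarrow> 0"
  shows "weak_rot G f h"
  unfolding weak_rot_def
proof (intro conjI allI impI)
  fix \<phi> :: "real^3 \<Rightarrow> real^3" assume \<phi>: "test_function G \<phi>"
  have "(\<lambda>n. L2_inner G (F n) (curl \<phi>)) \<longlonglongrightarrow> L2_inner G f (curl \<phi>)"
    by (intro tendsto_L2_inner_left weak_rot_L2(1)[OF fg] f L2_curl_test_function G \<phi>)
  moreover have "(\<lambda>n. L2_inner G (H n) \<phi>) \<longlonglongrightarrow> L2_inner G h \<phi>"
    by (intro tendsto_L2_inner_left weak_rot_L2(2)[OF fg] h test_function_L2 G \<phi>)
  ultimately show "L2_inner G f (curl \<phi>) = L2_inner G h \<phi>"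
    by (simp add: weak_rot_D[OF fg \<phi>] LIMSEQ_unique)
qed (use f h in simp_all)

section \<open>The space \<open>V0\<close> and the kernel of the rotor\<close>

lemma V0_iff:
  "u \<in> V0 G \<longleftrightarrow> u \<in> L2 G \<and> (\<forall>h g. weak_grad G h g \<longrightarrow> L2_inner G u g = 0) \<and>
     (\<forall>w\<in>B_H G. L2_inner G u w = 0)"
  by (auto simp: V0_def B_space_def)

lemma V0_L2: "u \<in> V0 G \<Longrightarrow> u \<in> L2 G"
  by (simp add: V0_iff)

lemma weak_grad_L2: "weak_grad G h g \<Longrightarrow> g \<in> L2 G"
  by (simp add: weak_grad_def)

lemma B_H_L2: "w \<in> B_H G \<Longrightarrow> w \<in> L2 G"
  by (simp add: B_H_def)

lemma V0_add:
  assumes "u \<in> V0 G" "w \<in> V0 G"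
  shows "(\<lambda>x. u x + w x) \<in> V0 G"
  using assms weak_grad_L2 B_H_L2 by (simp add: V0_iff L2_add L2_inner_add_left)

lemma V0_scaleR: "u \<in> V0 G \<Longrightarrow> (\<lambda>x. c *\<^sub>R u x) \<in> V0 G"
  by (simp add: V0_iff L2_scaleR L2_inner_scaleR_left)

lemma V0_diff:
  assumes "u \<in> V0 G" "w \<in> V0 G"
  shows "(\<lambda>x. u x - w x) \<in> V0 G"
  using V0_add[OF assms(1) V0_scaleR[OF assms(2), of "-1"]] by simp

lemma V0_sum: "(\<And>j. j \<in> J \<Longrightarrow> F j \<in> V0 G) \<Longrightarrow> (\<lambda>x. \<Sum>j\<in>J. F j x) \<in> V0 G"
proof (induction J rule: infinite_finite_induct)
  case (insert i J)
  then show ?case using V0_add[of "F i"] by simp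
qed (simp_all add: V0_iff L2_zero L2_inner_zero_left)

text \<open>An orthogonal complement is closed because the inner product is continuous. Sums of
  eigenfield series thereby stay in \<open>V0\<close>.\<close>

lemma V0_limit:
  assumes U: "\<And>n. U n \<in> V0 G" and u: "u \<in> L2 G"
    and lim: "(\<lambda>n. L2_norm G (\<lambda>x. u x - U n x)) \<longlonglongrightarrow> 0"
  shows "u \<in> V0 G"
proof -
  have *: "L2_inner G u g = 0" if "g \<in> L2 G" "\<And>n. L2_inner G (U n) g = 0" for g
    using tendsto_L2_inner_left[OF V0_L2[OF U] u that(1) lim] that(2) by (simp add: LIMSEQ_const_iff)
  show ?thesis
    unfolding V0_iff
  proof (intro conjI allI impI ballI)
    show "L2_inner G u g = 0" if "weak_grad G h g" for h g
      using that U by (intro *) (auto simp: V0_iff weak_grad_L2)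
    show "L2_inner G u w = 0" if "w \<in> B_H G" for w
      using that U by (intro *) (auto simp: V0_iff B_H_L2)
  qed (rule u)
qed

text \<open>Test functions are among the h of H^1, which gives zero divergence. With d = 0 Green's
  functional (u, grad h) + (d, h) is just the pairing with a gradient, so it vanishes too.\<close>

lemma B_space_normal_trace_zero:
  assumes G: "open G" "bounded G" and u: "u \<in> B_space G"
  shows "weak_div G u (\<lambda>_. 0)" "normal_trace_zero G u"
proof -
  show div: "weak_div G u (\<lambda>_. 0)"
    using u weak_grad_test_function[OF G]
    by (auto simp: weak_div_def B_space_def L2_zero L2_inner_zero_left)
  show "normal_trace_zero G u"
    unfolding normal_trace_zero_def using div u
    by (intro exI[of _ "\<lambda>_. 0"]) (auto simp: B_space_def L2_inner_zero_left)
qed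

lemma curl_free_B_space_imp_B_H:
  assumes "open G" "bounded G" "u \<in> B_space G" "weak_rot G u (\<lambda>_. 0)"
  shows "u \<in> B_H G"
  using assms B_space_normal_trace_zero[OF assms(1-3)] by (simp add: B_H_def weak_rot_def)

lemma curl_free_V0_eq_0:
  assumes "open G" "bounded G" "u \<in> V0 G" "weak_rot G u (\<lambda>_. 0)"
  shows "L2_eq G u (\<lambda>_. 0)"
proof -
  have "u \<in> B_H G" using assms by (intro curl_free_B_space_imp_B_H) (auto simp: V0_def)
  then have "L2_norm G u = 0" using assms(3) by (simp add: V0_def L2_norm_def)
  then show ?thesis using L2_norm_eq_0_iff V0_L2[OF assms(3)] by (auto simp: L2_eq_def)
qed

text \<open>Two solutions agree only almost everywhere, while \<open>B_H\<close> is a set of actual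
  functions; this places their difference in it.\<close>

lemma null_field_in_B_H:
  assumes G: "open G" "bounded G" and u: "u \<in> L2 G" "L2_eq G u (\<lambda>_. 0)"
  shows "u \<in> B_H G"
proof (rule curl_free_B_space_imp_B_H[OF G])
  show "weak_rot G u (\<lambda>_. 0)"
  proof (rule weak_rot_cong[OF G _ u(1) L2_eq_sym[OF u(2)] L2_zero L2_eq_refl])
    show "weak_rot G (\<lambda>_. 0) (\<lambda>_. 0)" by (simp add: weak_rot_def L2_zero L2_inner_zero_left)
  qed
  have "L2_inner G u g = 0" if "g \<in> L2 G" for g
    using L2_inner_cong_AE[of u G "\<lambda>_. 0" g g] u that
    by (simp add: L2_measurable L2_eq_refl L2_inner_zero_left)
  then show "u \<in> B_space G" using u by (auto simp: B_space_def weak_grad_L2)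
qed

text \<open>Each application of \<open>rot\<close> picks a fresh representative, so the eigenvalue
  equation is propagated through \<open>weak_rot\<close> and recovered almost everywhere by
  uniqueness.\<close>

lemma rot_power_eigenfield:
  assumes G: "open G" "bounded G" and q: "weak_rot G q (\<lambda>x. c *\<^sub>R q x)"
  shows "(rot G ^^ k) q \<in> L2 G \<and> L2_eq G ((rot G ^^ k) q) (\<lambda>x. c ^ k *\<^sub>R q x)"
proof (induction k)
  case 0
  then show ?case using weak_rot_L2[OF q] by (simp add: L2_eq_refl)
next
  case (Suc k)
  have w0: "weak_rot G (\<lambda>x. c ^ k *\<^sub>R q x) (\<lambda>x. c ^ k *\<^sub>R c *\<^sub>R q x)"
    using q by (rule weak_rot_scaleR)
  have w: "weak_rot G ((rot G ^^ k) q) (\<lambda>x. c ^ k *\<^sub>R c *\<^sub>R q x)"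
    using Suc by (intro weak_rot_cong[OF G w0 _ _ weak_rot_L2(2)[OF w0] L2_eq_refl]) (auto intro: L2_eq_sym)
  note r = weak_rot_rot[OF w]
  show ?case using weak_rot_unique[OF G r w] weak_rot_L2(2)[OF r] by (simp add: mult.commute)
qed

section \<open>The spectral decomposition\<close>

lemma summable_on_if_bounded_initial_sums:
  fixes c :: "nat \<Rightarrow> real"
  assumes "\<And>j. 0 \<le> c j" "\<And>N. (\<Sum>j=1..N. c j) \<le> C"
  shows "c summable_on {1..}"
proof (rule nonneg_bdd_above_summable_on)
  show "bdd_above (sum c ` {F. F \<subseteq> {1..} \<and> finite F})"
  proof (rule bdd_aboveI2)
    fix F :: "nat set" assume "F \<in> {F. F \<subseteq> {1..} \<and> finite F}"
    then have F: "F \<subseteq> {1..}" "finite F" by auto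
    then have "F \<subseteq> {1..Max F}" by auto
    then have "sum c F \<le> (\<Sum>j=1..Max F. c j)" using assms(1) by (intro sum_mono2) auto
    then show "sum c F \<le> C" using assms(2) by (rule order.trans)
  qed
qed (rule assms(1))

lemma convergent_initial_sums:
  fixes c :: "nat \<Rightarrow> real"
  assumes "\<And>j. 0 \<le> c j" "c summable_on {1..}"
  shows "convergent (\<lambda>N. \<Sum>j=1..N. c j)"
proof (rule Bseq_mono_convergent)
  have "(\<Sum>j=1..N. c j) \<le> infsum c {1..}" for N
    using assms by (intro finite_sum_le_infsum) auto
  then show "Bseq (\<lambda>N. \<Sum>j=1..N. c j)"
    using assms(1) by (intro BseqI'[of _ "infsum c {1..}"]) (simp add: abs_of_nonneg sum_nonneg)
  show "\<forall>m. \<forall>n\<ge>m. (\<Sum>j=1..m. c j) \<le> (\<Sum>j=1..n. c j)"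
    using assms(1) by (auto intro!: sum_mono2)
qed

lemma power_int_minus_double: "(x::real) powi (- 2 * int m) = inverse (x ^ (2 * m))"
  by (simp add: power_int_def nat_mult_distrib power_inverse)

lemma power_power2: "((x::'a::comm_monoid_mult) ^ k)\<^sup>2 = x ^ (2 * k)"
  by (simp add: power_mult[symmetric] mult.commute[of k])

lemma power_uminus_double: "(- x :: 'a::comm_ring_1) ^ (2 * k) = x ^ (2 * k)"
  by (simp add: power_mult)

text \<open>With c = lam^(2m), this exchanges the weight c on the coefficients of a solution for the
  weight 1/c on those of \<open>v\<close>, the one that defines \<open>W_neg\<close>.\<close>

lemma weighted_sum_squares_inverse:
  fixes c x y :: real
  assumes "c \<noteq> 0"
  shows "c * ((inverse c * x)\<^sup>2 + (inverse c * y)\<^sup>2) = inverse c * (x\<^sup>2 + y\<^sup>2)"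
  using assms by (simp add: field_simps power2_eq_square)

locale curl_spectrum =
  fixes G :: "(real^3) set" and lam :: "nat \<Rightarrow> real" and qp qm :: "nat \<Rightarrow> real^3 \<Rightarrow> real^3"
  assumes domain: "smooth_bounded_domain G"
    and basis: "curl_eigenbasis G lam qp qm"
begin

lemma G: "open G" "bounded G" "G \<in> lmeasurable"
  using domain by (auto simp: smooth_bounded_domain_def intro: lmeasurable_open)

lemma lam_pos: "1 \<le> j \<Longrightarrow> 0 < lam j"
  using basis by (simp add: curl_eigenbasis_def)

text \<open>The spectral gap: \<open>lam 1\<close> is the positive constant behind every comparison
  of series below.\<close>

lemma lam_ge: "1 \<le> j \<Longrightarrow> lam 1 \<le> lam j"
proof (induction j rule: dec_induct)
  case (step j)
  have "lam j \<le> lam (Suc j)" using basis step(1) unfolding curl_eigenbasis_def by blast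
  then show ?case using step by linarith
qed simp

lemma eigenfield_V0: "1 \<le> j \<Longrightarrow> qp j \<in> V0 G" "1 \<le> j \<Longrightarrow> qm j \<in> V0 G"
proof -
  have "q \<in> V0 G" if "q \<in> W G 1" for q
    using that unfolding W_def by (auto dest: spec[of _ 0])
  then show "1 \<le> j \<Longrightarrow> qp j \<in> V0 G" "1 \<le> j \<Longrightarrow> qm j \<in> V0 G"
    using basis unfolding curl_eigenbasis_def by blast+
qed

lemmas eigenfield_L2 = eigenfield_V0[THEN V0_L2]

text \<open>\<open>curl_eigenbasis\<close> speaks of the chosen rotor only; the existence clause of
  \<open>W G 1\<close> makes that choice a genuine weak rotor, which may then be replaced by the
  multiple of the eigenfield.\<close>

lemma weak_rot_eigenfield:
  "1 \<le> j \<Longrightarrow> weak_rot G (qp j) (\<lambda>x. lam j *\<^sub>R qp j x)"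
  "1 \<le> j \<Longrightarrow> weak_rot G (qm j) (\<lambda>x. (- lam j) *\<^sub>R qm j x)"
proof -
  have *: "weak_rot G q (\<lambda>x. c *\<^sub>R q x)"
    if "q \<in> W G 1" "L2_eq G (rot G q) (\<lambda>x. c *\<^sub>R q x)" for q c
  proof -
    have "\<exists>g. weak_rot G ((rot G ^^ 0) q) g" using that(1) unfolding W_def by blast
    then obtain g where "weak_rot G q g" by auto
    then have r: "weak_rot G q (rot G q)" by (rule weak_rot_rot)
    show ?thesis
      by (rule weak_rot_cong[OF G(1,2) r weak_rot_L2(1)[OF r] L2_eq_refl
            L2_scaleR[OF weak_rot_L2(1)[OF r]] that(2)])
  qed
  show "1 \<le> j \<Longrightarrow> weak_rot G (qp j) (\<lambda>x. lam j *\<^sub>R qp j x)"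
    "1 \<le> j \<Longrightarrow> weak_rot G (qm j) (\<lambda>x. (- lam j) *\<^sub>R qm j x)"
    using basis unfolding curl_eigenbasis_def by (blast intro: *)+
qed

lemma orthonormal:
  assumes "1 \<le> i" "1 \<le> j"
  shows "L2_inner G (qp i) (qp j) = (if i = j then 1 else 0)"
    "L2_inner G (qm i) (qm j) = (if i = j then 1 else 0)"
    "L2_inner G (qp i) (qm j) = 0" "L2_inner G (qm i) (qp j) = 0"
  using basis assms unfolding curl_eigenbasis_def by (auto simp: L2_inner_commute[of G "qm i" "qp j"])

section \<open>Finite and infinite expansions in eigenfields\<close>

definition eigen_sum :: "(nat \<Rightarrow> real) \<Rightarrow> (nat \<Rightarrow> real) \<Rightarrow> nat \<Rightarrow> real^3 \<Rightarrow> real^3" where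
  "eigen_sum a b N x = (\<Sum>j=1..N. a j *\<^sub>R qp j x + b j *\<^sub>R qm j x)"

text \<open>The coefficients are free parameters rather than inner products with \<open>u\<close>,
  so one predicate serves both to expand a given field and to construct a new one.\<close>

definition eigen_series :: "(nat \<Rightarrow> real) \<Rightarrow> (nat \<Rightarrow> real) \<Rightarrow> (real^3 \<Rightarrow> real^3) \<Rightarrow> bool" where
  "eigen_series a b u \<longleftrightarrow> L2_sums G (\<lambda>j x. a j *\<^sub>R qp j x + b j *\<^sub>R qm j x) u"

lemma mode_V0: "1 \<le> j \<Longrightarrow> (\<lambda>x. a *\<^sub>R qp j x + b *\<^sub>R qm j x) \<in> V0 G"
  by (intro V0_add V0_scaleR eigenfield_V0)

lemma eigen_sum_V0: "eigen_sum a b N \<in> V0 G"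
  unfolding eigen_sum_def[abs_def] by (intro V0_sum mode_V0) auto

lemmas eigen_sum_L2 = eigen_sum_V0[THEN V0_L2]

lemma eigen_series_iff:
  "eigen_series a b u \<longleftrightarrow> u \<in> L2 G \<and> (\<lambda>N. L2_norm G (\<lambda>x. u x - eigen_sum a b N x)) \<longlonglongrightarrow> 0"
  using mode_V0[THEN V0_L2] by (simp add: eigen_series_def L2_sums_def eigen_sum_def)

lemma eigen_series_V0: "eigen_series a b u \<Longrightarrow> u \<in> V0 G"
  using V0_limit[of "eigen_sum a b", OF eigen_sum_V0] by (simp add: eigen_series_iff)

lemma L2_inner_eigen_sum:
  assumes "f \<in> L2 G"
  shows "L2_inner G (eigen_sum a b N) f = (\<Sum>j=1..N. a j * L2_inner G (qp j) f + b j * L2_inner G (qm j) f)"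
proof -
  have "L2_inner G (eigen_sum a b N) f = (\<Sum>j=1..N. L2_inner G (\<lambda>x. a j *\<^sub>R qp j x + b j *\<^sub>R qm j x) f)"
    unfolding eigen_sum_def[abs_def] by (intro L2_inner_sum_left mode_V0[THEN V0_L2] assms) auto
  also have "\<dots> = (\<Sum>j=1..N. a j * L2_inner G (qp j) f + b j * L2_inner G (qm j) f)"
    by (intro sum.cong refl) (simp add: L2_inner_add_left L2_inner_scaleR_left L2_scaleR eigenfield_L2 assms)
  finally show ?thesis .
qed

lemma L2_inner_eigen_sum_eigenfield:
  assumes "1 \<le> i"
  shows "L2_inner G (eigen_sum a b N) (qp i) = (if i \<le> N then a i else 0)"
    "L2_inner G (eigen_sum a b N) (qm i) = (if i \<le> N then b i else 0)"
proof -
  have "L2_inner G (eigen_sum a b N) (qp i) = (\<Sum>j=1..N. if j = i then a j else 0)"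
    unfolding L2_inner_eigen_sum[OF eigenfield_L2(1)[OF assms]]
    by (intro sum.cong refl) (simp add: orthonormal[OF _ assms] del: One_nat_def)
  then show "L2_inner G (eigen_sum a b N) (qp i) = (if i \<le> N then a i else 0)"
    using assms by simp
  have "L2_inner G (eigen_sum a b N) (qm i) = (\<Sum>j=1..N. if j = i then b j else 0)"
    unfolding L2_inner_eigen_sum[OF eigenfield_L2(2)[OF assms]]
    by (intro sum.cong refl) (simp add: orthonormal[OF _ assms] del: One_nat_def)
  then show "L2_inner G (eigen_sum a b N) (qm i) = (if i \<le> N then b i else 0)"
    using assms by simp
qed

lemma L2_inner_eigen_sum_self:
  "L2_inner G (eigen_sum a b N) (eigen_sum a b N) = (\<Sum>j=1..N. (a j)\<^sup>2 + (b j)\<^sup>2)"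
  unfolding L2_inner_eigen_sum[OF eigen_sum_L2]
  by (intro sum.cong refl)
    (simp add: L2_inner_commute[of G _ "eigen_sum a b N"] L2_inner_eigen_sum_eigenfield power2_eq_square)

text \<open>The difference is again an \<open>eigen_sum\<close>, with the coefficients up to
  \<open>M\<close> replaced by 0, so orthonormality gives its norm.\<close>

lemma L2_norm_eigen_sum_diff:
  assumes "M \<le> N"
  shows "(L2_norm G (\<lambda>x. eigen_sum a b N x - eigen_sum a b M x))\<^sup>2 =
    (\<Sum>j=1..N. (a j)\<^sup>2 + (b j)\<^sup>2) - (\<Sum>j=1..M. (a j)\<^sup>2 + (b j)\<^sup>2)"
proof -
  have split: "(\<Sum>j=1..N. c j) = (\<Sum>j=1..M. c j) + (\<Sum>j=1..N. if M < j then c j else 0)"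
    for c :: "nat \<Rightarrow> 'c::ab_group_add"
  proof -
    have "(\<Sum>j=1..N. c j) = (\<Sum>j=1..N. if j \<le> M then c j else 0) + (\<Sum>j=1..N. if M < j then c j else 0)"
      unfolding sum.distrib[symmetric] by (intro sum.cong refl) auto
    moreover have "(\<Sum>j=1..N. if j \<le> M then c j else 0) = (\<Sum>j=1..M. c j)"
      using assms by (intro sum.mono_neutral_cong_right) auto
    ultimately show ?thesis by simp
  qed
  let ?a = "\<lambda>j. if M < j then a j else 0" and ?b = "\<lambda>j. if M < j then b j else 0"
  have "(\<lambda>x. eigen_sum a b N x - eigen_sum a b M x) = eigen_sum ?a ?b N"
  proof
    fix x
    show "eigen_sum a b N x - eigen_sum a b M x = eigen_sum ?a ?b N x"
      unfolding eigen_sum_def split[of "\<lambda>j. a j *\<^sub>R qp j x + b j *\<^sub>R qm j x"] add_diff_cancel_left'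
      by (intro sum.cong refl) auto
  qed
  then have "(L2_norm G (\<lambda>x. eigen_sum a b N x - eigen_sum a b M x))\<^sup>2 = (\<Sum>j=1..N. (?a j)\<^sup>2 + (?b j)\<^sup>2)"
    by (simp add: L2_norm_power2 L2_inner_eigen_sum_self)
  also have "\<dots> = (\<Sum>j=1..N. if M < j then (a j)\<^sup>2 + (b j)\<^sup>2 else 0)"
    by (intro sum.cong refl) auto
  finally show ?thesis using split[of "\<lambda>j. (a j)\<^sup>2 + (b j)\<^sup>2"] by simp
qed

text \<open>The inner product of the partial sum with the i-th eigenfield is constant from N = i on,
  and inner products pass to the limit.\<close>

lemma eigen_series_coeffs:
  assumes u: "eigen_series a b u" and i: "1 \<le> i"
  shows "L2_inner G u (qp i) = a i" "L2_inner G u (qm i) = b i"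
proof -
  have lim: "(\<lambda>N. L2_inner G (eigen_sum a b N) g) \<longlonglongrightarrow> L2_inner G u g" if "g \<in> L2 G" for g
    using u that unfolding eigen_series_iff by (intro tendsto_L2_inner_left eigen_sum_L2) auto
  have ev: "(\<lambda>N. L2_inner G (eigen_sum a b N) g) \<longlonglongrightarrow> c"
    if "\<And>N. i \<le> N \<Longrightarrow> L2_inner G (eigen_sum a b N) g = c" for g c
    using that by (intro tendsto_eventually) (auto simp: eventually_sequentially)
  show "L2_inner G u (qp i) = a i"
    by (intro LIMSEQ_unique[OF lim ev] eigenfield_L2 i) (simp add: L2_inner_eigen_sum_eigenfield[OF i])
  show "L2_inner G u (qm i) = b i"
    by (intro LIMSEQ_unique[OF lim ev] eigenfield_L2 i) (simp add: L2_inner_eigen_sum_eigenfield[OF i])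
qed

lemma Bessel_summable:
  assumes f: "f \<in> L2 G"
  shows "(\<lambda>j. (L2_inner G f (qp j))\<^sup>2 + (L2_inner G f (qm j))\<^sup>2) summable_on {1..}"
proof (rule summable_on_if_bounded_initial_sums)
  fix N
  let ?a = "\<lambda>j. L2_inner G f (qp j)" and ?b = "\<lambda>j. L2_inner G f (qm j)"
  let ?p = "eigen_sum ?a ?b N" and ?S = "\<Sum>j=1..N. (?a j)\<^sup>2 + (?b j)\<^sup>2"
  have pf: "L2_inner G ?p f = ?S"
    unfolding L2_inner_eigen_sum[OF f] by (simp add: power2_eq_square L2_inner_commute[of G _ f])
  have "0 \<le> L2_inner G (\<lambda>x. f x - ?p x) (\<lambda>x. f x - ?p x)" by (rule L2_inner_nonneg)
  also have "\<dots> = L2_inner G f f - 2 * L2_inner G ?p f + L2_inner G ?p ?p"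
    using f eigen_sum_L2 by (simp add: L2_inner_diff_left L2_inner_diff_right L2_diff L2_inner_commute[of G f ?p])
  also have "\<dots> = L2_inner G f f - ?S" unfolding pf L2_inner_eigen_sum_self by simp
  finally show "?S \<le> L2_inner G f f" by simp
qed simp

text \<open>Squared distances of partial sums are differences of partial sums of the convergent
  scalar series, so the partial sums are Cauchy and \<open>L2_complete\<close> gives a
  limit.\<close>

lemma eigen_series_exists:
  assumes sm: "(\<lambda>j. (a j)\<^sup>2 + (b j)\<^sup>2) summable_on {1..}"
  obtains u where "eigen_series a b u"
proof -
  define S where "S N = (\<Sum>j=1..N. (a j)\<^sup>2 + (b j)\<^sup>2)" for N
  have "convergent S" unfolding S_def using sm by (intro convergent_initial_sums) auto
  then have CS: "Cauchy S" by (rule convergent_Cauchy)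
  have "\<exists>K. \<forall>m\<ge>K. \<forall>n\<ge>K. L2_norm G (\<lambda>x. eigen_sum a b m x - eigen_sum a b n x) \<le> e" if e: "0 < e" for e
  proof -
    obtain K where K: "\<And>m n. K \<le> m \<Longrightarrow> K \<le> n \<Longrightarrow> norm (S m - S n) < e\<^sup>2"
      using CauchyD[OF CS, of "e\<^sup>2"] e by auto
    have le: "L2_norm G (\<lambda>x. eigen_sum a b m x - eigen_sum a b n x) \<le> e" if "K \<le> n" "n \<le> m" for m n
    proof (rule power2_le_imp_le)
      show "(L2_norm G (\<lambda>x. eigen_sum a b m x - eigen_sum a b n x))\<^sup>2 \<le> e\<^sup>2"
        unfolding L2_norm_eigen_sum_diff[OF that(2)] S_def[symmetric] using K[of m n] that by simp
    qed (use e in simp)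
    show ?thesis
    proof (intro exI[of _ K] allI impI)
      fix m n assume "K \<le> m" "K \<le> n"
      then show "L2_norm G (\<lambda>x. eigen_sum a b m x - eigen_sum a b n x) \<le> e"
        using le[of n m] le[of m n] L2_norm_minus_commute[of G "eigen_sum a b m" "eigen_sum a b n"]
        by (cases "n \<le> m") auto
    qed
  qed
  then obtain u where "u \<in> L2 G" "(\<lambda>n. L2_norm G (\<lambda>x. u x - eigen_sum a b n x)) \<longlonglongrightarrow> 0"
    by (rule L2_complete[of G "eigen_sum a b", OF G(3) eigen_sum_L2])
  then show ?thesis by (intro that[of u]) (simp add: eigen_series_iff)
qed

lemma eigen_series_V0_coeffs:
  "f \<in> V0 G \<Longrightarrow> eigen_series (\<lambda>j. L2_inner G f (qp j)) (\<lambda>j. L2_inner G f (qm j)) f"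
  using basis unfolding eigen_series_def curl_eigenbasis_def by blast

lemma eigen_series_unique:
  assumes "eigen_series a b u" "eigen_series a b w"
  shows "L2_eq G u w"
  using assms unfolding eigen_series_iff by (intro L2_limit_unique[OF eigen_sum_L2]) auto

lemma eigen_series_cong:
  assumes "eigen_series a b u" "\<And>j. 1 \<le> j \<Longrightarrow> a j = a' j" "\<And>j. 1 \<le> j \<Longrightarrow> b j = b' j"
  shows "eigen_series a' b' u"
proof -
  have "eigen_sum a b N = eigen_sum a' b' N" for N
    unfolding eigen_sum_def[abs_def] using assms(2,3) by (intro ext sum.cong) auto
  then show ?thesis using assms(1) by (simp add: eigen_series_iff)
qed

lemma eigen_series_L2_eq:
  assumes u: "eigen_series a b u" and w: "w \<in> L2 G" "L2_eq G u w"
  shows "eigen_series a b w"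
proof -
  have uL: "u \<in> L2 G" using u by (simp add: eigen_series_iff)
  have "L2_norm G (\<lambda>x. w x - eigen_sum a b N x) = L2_norm G (\<lambda>x. u x - eigen_sum a b N x)" for N
  proof -
    have "L2_eq G (\<lambda>x. w x - eigen_sum a b N x) (\<lambda>x. u x - eigen_sum a b N x)"
      using w(2) unfolding L2_eq_def by eventually_elim simp
    then show ?thesis unfolding L2_norm_def
      by (intro arg_cong[of _ _ sqrt] L2_inner_cong_AE L2_measurable L2_diff uL w(1) eigen_sum_L2)
  qed
  then show ?thesis using u w(1) by (simp add: eigen_series_iff)
qed

text \<open>Finite sums have their rotor term by term, and the rotor is closed. Convergence of the
  differentiated series is an input here, not a consequence.\<close>

lemma weak_rot_eigen_series:
  assumes u: "eigen_series a b u" and w: "eigen_series (\<lambda>j. lam j * a j) (\<lambda>j. - lam j * b j) w"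
  shows "weak_rot G u w"
proof (rule weak_rot_limit[OF G(1,2)])
  fix N
  have "weak_rot G (\<lambda>x. a j *\<^sub>R qp j x + b j *\<^sub>R qm j x)
      (\<lambda>x. (lam j * a j) *\<^sub>R qp j x + (- lam j * b j) *\<^sub>R qm j x)" if "1 \<le> j" for j
    using weak_rot_add[OF G(1,2) weak_rot_scaleR[OF weak_rot_eigenfield(1)[OF that], of "a j"]
        weak_rot_scaleR[OF weak_rot_eigenfield(2)[OF that], of "b j"]]
    by (simp add: mult.commute)
  then show "weak_rot G (eigen_sum a b N) (eigen_sum (\<lambda>j. lam j * a j) (\<lambda>j. - lam j * b j) N)"
    unfolding eigen_sum_def[abs_def] by (intro weak_rot_sum[OF G(1,2)]) auto
qed (use u w in \<open>auto simp: eigen_series_iff\<close>)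

text \<open>The substitute for moving the rotor onto an eigenfield: \<open>f\<close> is shown to
  agree almost everywhere with a series whose coefficients are known by construction.\<close>

lemma weak_rot_coeffs:
  assumes fg: "weak_rot G f g" and f: "f \<in> V0 G" and g: "g \<in> V0 G" and j: "1 \<le> j"
  shows "L2_inner G g (qp j) = lam j * L2_inner G f (qp j)"
    "L2_inner G g (qm j) = - lam j * L2_inner G f (qm j)"
proof -
  \<comment> \<open>Division by the eigenvalues \<open>lam i\<close> and \<open>- lam i\<close>
    inverts the rotor on coefficients: the series \<open>u\<close> built from them has
    \<open>g\<close> as weak rotor.\<close>
  define a where "a i = L2_inner G g (qp i) / lam i" for i
  define b where "b i = - L2_inner G g (qm i) / lam i" for i
  have "(\<lambda>i. (a i)\<^sup>2 + (b i)\<^sup>2) summable_on {1..}"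
  proof (rule summable_on_comparison_test)
    \<comment> \<open>Since \<open>lam i\<close> is at least \<open>lam 1\<close>, dividing by
      eigenvalues costs at most this constant, and Bessel's inequality for \<open>g\<close> bounds
      the rest.\<close>
    show "(\<lambda>i. inverse ((lam 1)\<^sup>2) * ((L2_inner G g (qp i))\<^sup>2 + (L2_inner G g (qm i))\<^sup>2)) summable_on {1..}"
      by (intro summable_on_cmult_right Bessel_summable V0_L2 g)
    fix i :: nat assume "i \<in> {1..}"
    then have i: "1 \<le> i" by simp
    have "inverse ((lam i)\<^sup>2) \<le> inverse ((lam 1)\<^sup>2)"
      using lam_ge[OF i] lam_pos[of 1] by (intro le_imp_inverse_le power_mono) auto
    moreover have "(a i)\<^sup>2 + (b i)\<^sup>2 = inverse ((lam i)\<^sup>2) * ((L2_inner G g (qp i))\<^sup>2 + (L2_inner G g (qm i))\<^sup>2)"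
      by (simp add: a_def b_def divide_inverse power_mult_distrib power_inverse algebra_simps)
    ultimately show "(a i)\<^sup>2 + (b i)\<^sup>2 \<le> inverse ((lam 1)\<^sup>2) * ((L2_inner G g (qp i))\<^sup>2 + (L2_inner G g (qm i))\<^sup>2)"
      by (simp add: mult_right_mono)
  qed simp
  then obtain u where u: "eigen_series a b u" by (rule eigen_series_exists)
  have "eigen_series (\<lambda>i. lam i * a i) (\<lambda>i. - lam i * b i) g"
    by (rule eigen_series_cong[OF eigen_series_V0_coeffs[OF g]])
      (use lam_pos in \<open>auto simp: a_def b_def less_imp_neq[symmetric]\<close>)
  then have ug: "weak_rot G u g" by (rule weak_rot_eigen_series[OF u])
  note uV = eigen_series_V0[OF u]
  have "weak_rot G (\<lambda>x. f x - u x) (\<lambda>_. 0)"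
    using weak_rot_diff[OF G(1,2) fg ug] by simp
  then have "L2_eq G (\<lambda>x. f x - u x) (\<lambda>_. 0)"
    by (rule curl_free_V0_eq_0[OF G(1,2) V0_diff[OF f uV]])
  then have fu: "L2_eq G f u" by (simp add: L2_eq_def)
  have "L2_inner G f q = L2_inner G u q" if "q \<in> L2 G" for q
    by (intro L2_inner_cong_AE L2_measurable V0_L2 f uV that fu L2_eq_refl)
  then show "L2_inner G g (qp j) = lam j * L2_inner G f (qp j)"
    "L2_inner G g (qm j) = - lam j * L2_inner G f (qm j)"
    using eigen_series_coeffs[OF u j] eigenfield_L2[OF j] lam_pos[OF j] by (simp_all add: a_def b_def)
qed

section \<open>Iterated rotors in terms of eigencoefficients\<close>

lemma W_V0: "u \<in> W G m \<Longrightarrow> u \<in> V0 G"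
  unfolding W_def by (auto dest: spec[of _ 0])

text \<open>For each k < m membership in \<open>W G m\<close> supplies what
  \<open>weak_rot_coeffs\<close> asks for: two consecutive iterates in \<open>V0\<close> and the
  existence of a weak rotor.\<close>

lemma rot_power_coeffs:
  assumes u: "u \<in> W G m" and j: "1 \<le> j" and "k \<le> m"
  shows "L2_inner G ((rot G ^^ k) u) (qp j) = lam j ^ k * L2_inner G u (qp j) \<and>
    L2_inner G ((rot G ^^ k) u) (qm j) = (- lam j) ^ k * L2_inner G u (qm j)"
  using assms(3)
proof (induction k)
  case (Suc k)
  obtain g where "weak_rot G ((rot G ^^ k) u) g"
    using u Suc.prems unfolding W_def by (blast dest: Suc_le_lessD)
  from weak_rot_rot[OF this] have r: "weak_rot G ((rot G ^^ k) u) ((rot G ^^ Suc k) u)"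
    by simp
  have V: "(rot G ^^ k) u \<in> V0 G" "(rot G ^^ Suc k) u \<in> V0 G"
    using u Suc.prems unfolding W_def by (auto simp del: funpow.simps)
  show ?case
    using weak_rot_coeffs[OF r V j] Suc by (simp del: funpow.simps)
qed simp

text \<open>Either argument of the inner product contributes the m-th power of the eigenvalue,
  \<open>u\<close> by \<open>rot_power_coeffs\<close> and the eigenfield by
  \<open>rot_power_eigenfield\<close>. The sign of a negative eigenvalue cancels in the power
  2m.\<close>

lemma solves_rot_eq_iff:
  assumes u: "u \<in> W G m"
  shows "solves_rot_eq G qp qm m u v \<longleftrightarrow>
    (\<forall>j\<ge>1. lam j ^ (2 * m) * L2_inner G u (qp j) = v (qp j) \<and>
           lam j ^ (2 * m) * L2_inner G u (qm j) = v (qm j))"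
proof -
  have rL: "(rot G ^^ m) u \<in> L2 G" using u by (auto simp: W_def V0_L2)
  have *: "L2_inner G ((rot G ^^ m) u) ((rot G ^^ m) q) = c ^ m * L2_inner G ((rot G ^^ m) u) q"
    if "weak_rot G q (\<lambda>x. c *\<^sub>R q x)" for q c
  proof -
    have "L2_inner G ((rot G ^^ m) u) ((rot G ^^ m) q) = L2_inner G ((rot G ^^ m) u) (\<lambda>x. c ^ m *\<^sub>R q x)"
      using rot_power_eigenfield[OF G(1,2) that, of m] weak_rot_L2(1)[OF that]
      by (intro L2_inner_cong_AE L2_measurable rL L2_scaleR L2_eq_refl) auto
    then show ?thesis by (simp add: L2_inner_scaleR_right)
  qed
  have "L2_inner G ((rot G ^^ m) u) ((rot G ^^ m) (qp j)) = lam j ^ (2 * m) * L2_inner G u (qp j) \<and>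
      L2_inner G ((rot G ^^ m) u) ((rot G ^^ m) (qm j)) = lam j ^ (2 * m) * L2_inner G u (qm j)"
    if j: "1 \<le> j" for j
  proof -
    have "(- lam j) ^ m * (- lam j) ^ m = lam j ^ (2 * m)"
      using power_power2[of "- lam j" m] by (simp only: power2_eq_square power_uminus_double)
    moreover have "lam j ^ m * lam j ^ m = lam j ^ (2 * m)"
      using power_power2[of "lam j" m] by (simp only: power2_eq_square)
    ultimately show ?thesis
      using rot_power_coeffs[OF u j order.refl]
      by (simp add: *[OF weak_rot_eigenfield(1)[OF j]] *[OF weak_rot_eigenfield(2)[OF j]]
          mult.assoc[symmetric])
  qed
  then show ?thesis unfolding solves_rot_eq_def by auto
qed

text \<open>The weight at level m controls all lower levels because of the spectral gap, so every
  termwise rotor up to order m converges; the chosen iterates are then identified with these series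
  one after the other.\<close>

lemma eigen_series_in_W:
  assumes sm: "(\<lambda>j. lam j ^ (2 * m) * ((a j)\<^sup>2 + (b j)\<^sup>2)) summable_on {1..}"
    and u: "eigen_series a b u"
  shows "u \<in> W G m"
proof -
  have series: "\<exists>w. eigen_series (\<lambda>j. lam j ^ k * a j) (\<lambda>j. (- lam j) ^ k * b j) w" if "k \<le> m" for k
  proof -
    have "(\<lambda>j. (lam j ^ k * a j)\<^sup>2 + ((- lam j) ^ k * b j)\<^sup>2) summable_on {1..}"
    proof (rule summable_on_comparison_test)
      \<comment> \<open>The constant comes from lam^(2k) = lam^(2m) / lam^(2(m-k)) with the
        denominator estimated below by the first eigenvalue.\<close>
      show "(\<lambda>j. inverse (lam 1 ^ (2 * (m - k))) * (lam j ^ (2 * m) * ((a j)\<^sup>2 + (b j)\<^sup>2))) summable_on {1..}"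
        by (intro summable_on_cmult_right sm)
      fix j :: nat assume "j \<in> {1..}"
      then have j: "1 \<le> j" by simp
      have "lam 1 ^ (2 * (m - k)) \<le> lam j ^ (2 * (m - k))"
        using lam_ge[OF j] lam_pos[of 1] by (intro power_mono) auto
      then have "lam j ^ (2 * k) * lam 1 ^ (2 * (m - k)) \<le> lam j ^ (2 * k) * lam j ^ (2 * (m - k))"
        using lam_pos[OF j] by (intro mult_left_mono) auto
      also have "\<dots> = lam j ^ (2 * m)"
        using that by (simp add: power_add[symmetric] algebra_simps)
      finally have "lam j ^ (2 * k) \<le> inverse (lam 1 ^ (2 * (m - k))) * lam j ^ (2 * m)"
        using lam_pos[of 1] by (simp add: field_simps)
      then have "lam j ^ (2 * k) * ((a j)\<^sup>2 + (b j)\<^sup>2)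
          \<le> inverse (lam 1 ^ (2 * (m - k))) * lam j ^ (2 * m) * ((a j)\<^sup>2 + (b j)\<^sup>2)"
        by (intro mult_right_mono) auto
      moreover have "(lam j ^ k * a j)\<^sup>2 + ((- lam j) ^ k * b j)\<^sup>2 = lam j ^ (2 * k) * ((a j)\<^sup>2 + (b j)\<^sup>2)"
        by (simp only: power_mult_distrib power_power2 power_uminus_double distrib_left)
      ultimately show "(lam j ^ k * a j)\<^sup>2 + ((- lam j) ^ k * b j)\<^sup>2
          \<le> inverse (lam 1 ^ (2 * (m - k))) * (lam j ^ (2 * m) * ((a j)\<^sup>2 + (b j)\<^sup>2))"
        by (simp add: mult.assoc)
    qed simp
    then show ?thesis by (rule eigen_series_exists) blast
  qed
  have rot_series: "weak_rot G f (rot G f) \<and>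
      eigen_series (\<lambda>j. lam j ^ Suc k * a j) (\<lambda>j. (- lam j) ^ Suc k * b j) (rot G f)"
    if k: "k < m" and f: "eigen_series (\<lambda>j. lam j ^ k * a j) (\<lambda>j. (- lam j) ^ k * b j) f" for k f
  proof -
    obtain w where w: "eigen_series (\<lambda>j. lam j ^ Suc k * a j) (\<lambda>j. (- lam j) ^ Suc k * b j) w"
      using series[of "Suc k"] k by auto
    have fw: "weak_rot G f w"
      using f w by (intro weak_rot_eigen_series) (simp_all add: mult.assoc)
    note r = weak_rot_rot[OF fw]
    show ?thesis
      \<comment> \<open>\<open>rot G f\<close> need not be \<open>w\<close> itself; both are weak
        rotors of \<open>f\<close>, so they agree almost everywhere and share the expansion.\<close>
      using r eigen_series_L2_eq[OF w weak_rot_L2(2)[OF r] weak_rot_unique[OF G(1,2) fw r]] by blast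
  qed
  have pow: "eigen_series (\<lambda>j. lam j ^ k * a j) (\<lambda>j. (- lam j) ^ k * b j) ((rot G ^^ k) u)" if "k \<le> m" for k
    using that
  proof (induction k)
    case (Suc k)
    then have "k < m" "k \<le> m" by simp_all
    then show ?case using rot_series[OF _ Suc.IH] by simp
  qed (simp add: u)
  show ?thesis
    unfolding W_def using eigen_series_V0[OF pow] rot_series[OF _ pow] by (blast intro: less_imp_le)
qed

text \<open>By orthonormality only the term j = i can be nonzero, so the infinite sum reduces to a
  singleton whatever the growth of the coefficients.\<close>

lemma dual_functional_eigenfield:
  assumes "1 \<le> i"
  shows "dual_functional G qp qm a b (qp i) = a i" "dual_functional G qp qm a b (qm i) = b i"
proof -
  have "(\<Sum>\<^sub>\<infinity>j\<in>{1..}. a j * L2_inner G (qp i) (qp j) + b j * L2_inner G (qp i) (qm j)) = (\<Sum>\<^sub>\<infinity>j\<in>{i}. a j)"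
    by (rule infsum_cong_neutral) (use assms in \<open>auto simp: orthonormal\<close>)
  then show "dual_functional G qp qm a b (qp i) = a i" by (simp add: dual_functional_def)
  have "(\<Sum>\<^sub>\<infinity>j\<in>{1..}. a j * L2_inner G (qm i) (qp j) + b j * L2_inner G (qm i) (qm j)) = (\<Sum>\<^sub>\<infinity>j\<in>{i}. b j)"
    by (rule infsum_cong_neutral) (use assms in \<open>auto simp: orthonormal\<close>)
  then show "dual_functional G qp qm a b (qm i) = b i" by (simp add: dual_functional_def)
qed

text \<open>The coefficients hidden in the existential of \<open>W_neg\<close> are recovered as
  values on eigenfields. In the converse direction, membership in \<open>B_star\<close> ensures that
  \<open>v\<close> is a \<open>dual_functional\<close> at all.\<close>

lemma W_neg_iff:
  assumes "v \<in> B_star G lam qp qm"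
  shows "v \<in> W_neg G lam qp qm m \<longleftrightarrow>
    (\<lambda>j. inverse (lam j ^ (2 * m)) * ((v (qp j))\<^sup>2 + (v (qm j))\<^sup>2)) summable_on {1..}"
proof
  assume "v \<in> W_neg G lam qp qm m"
  then obtain a b where v: "v = dual_functional G qp qm a b"
    and "(\<lambda>j. lam j powi (- 2 * int m) * ((a j)\<^sup>2 + (b j)\<^sup>2)) summable_on {1..}"
    unfolding W_neg_def by blast
  then have "(\<lambda>j. inverse (lam j ^ (2 * m)) * ((a j)\<^sup>2 + (b j)\<^sup>2)) summable_on {1..}"
    unfolding power_int_minus_double by simp
  then show "(\<lambda>j. inverse (lam j ^ (2 * m)) * ((v (qp j))\<^sup>2 + (v (qm j))\<^sup>2)) summable_on {1..}"
    by (rule summable_on_cong[THEN iffD1, rotated]) (simp add: v dual_functional_eigenfield)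
next
  assume sm: "(\<lambda>j. inverse (lam j ^ (2 * m)) * ((v (qp j))\<^sup>2 + (v (qm j))\<^sup>2)) summable_on {1..}"
  obtain a b where v: "v = dual_functional G qp qm a b"
    using assms unfolding B_star_def W_neg_def by blast
  have "(\<lambda>j. inverse (lam j ^ (2 * m)) * ((a j)\<^sup>2 + (b j)\<^sup>2)) summable_on {1..}"
    by (rule summable_on_cong[THEN iffD1, OF _ sm]) (simp add: v dual_functional_eigenfield)
  then show "v \<in> W_neg G lam qp qm m"
    unfolding W_neg_def power_int_minus_double using v by blast
qed

section \<open>Solvability and the formula for the solution\<close>

lemma solution_coeffs:
  assumes "u \<in> W G m" "solves_rot_eq G qp qm m u v" "1 \<le> j"
  shows "L2_inner G u (qp j) = inverse (lam j ^ (2 * m)) * v (qp j)"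
    "L2_inner G u (qm j) = inverse (lam j ^ (2 * m)) * v (qm j)"
proof -
  have "lam j ^ (2 * m) * L2_inner G u (qp j) = v (qp j)" "lam j ^ (2 * m) * L2_inner G u (qm j) = v (qm j)"
    using assms(2,3) unfolding solves_rot_eq_iff[OF assms(1)] by auto
  then show "L2_inner G u (qp j) = inverse (lam j ^ (2 * m)) * v (qp j)"
    "L2_inner G u (qm j) = inverse (lam j ^ (2 * m)) * v (qm j)"
    using lam_pos[OF assms(3)] by (auto simp: field_simps)
qed

lemma solution_eigen_series:
  assumes "u \<in> W G m" "solves_rot_eq G qp qm m u v"
  shows "eigen_series (\<lambda>j. inverse (lam j ^ (2 * m)) * v (qp j)) (\<lambda>j. inverse (lam j ^ (2 * m)) * v (qm j)) u"
  by (rule eigen_series_cong[OF eigen_series_V0_coeffs[OF W_V0[OF assms(1)]]])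
    (simp_all add: solution_coeffs[OF assms])

lemma solvable_iff:
  assumes v: "v \<in> B_star G lam qp qm"
  shows "(\<exists>u\<in>W G m. solves_rot_eq G qp qm m u v) \<longleftrightarrow> v \<in> W_neg G lam qp qm m"
  unfolding W_neg_iff[OF v]
proof
  assume "\<exists>u\<in>W G m. solves_rot_eq G qp qm m u v"
  then obtain u where u: "u \<in> W G m" "solves_rot_eq G qp qm m u v" by blast
  have "(rot G ^^ m) u \<in> L2 G" using u(1) by (auto simp: W_def V0_L2)
  \<comment> \<open>Bessel is applied to the m-th rotor rather than to \<open>u\<close>: its
    coefficients are, up to sign, lam^(-m) times the values of \<open>v\<close>, and their squares
    carry exactly the weight of \<open>W_neg\<close>.\<close>
  from Bessel_summable[OF this]
  show "(\<lambda>j. inverse (lam j ^ (2 * m)) * ((v (qp j))\<^sup>2 + (v (qm j))\<^sup>2)) summable_on {1..}"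
  proof (rule summable_on_cong[THEN iffD1, rotated])
    fix j :: nat assume "j \<in> {1..}"
    then have j: "1 \<le> j" by simp
    have nz: "lam j ^ (2 * m) \<noteq> 0" using lam_pos[OF j] by simp
    show "(L2_inner G ((rot G ^^ m) u) (qp j))\<^sup>2 + (L2_inner G ((rot G ^^ m) u) (qm j))\<^sup>2 =
        inverse (lam j ^ (2 * m)) * ((v (qp j))\<^sup>2 + (v (qm j))\<^sup>2)"
      unfolding rot_power_coeffs[OF u(1) j order.refl, THEN conjunct1]
        rot_power_coeffs[OF u(1) j order.refl, THEN conjunct2]
        solution_coeffs[OF u j] power_mult_distrib[of "lam j ^ m"] power_mult_distrib[of "(- lam j) ^ m"]
        power_power2 power_uminus_double distrib_left[symmetric]
      by (rule weighted_sum_squares_inverse[OF nz])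
  qed
next
  assume sm: "(\<lambda>j. inverse (lam j ^ (2 * m)) * ((v (qp j))\<^sup>2 + (v (qm j))\<^sup>2)) summable_on {1..}"
  define a where "a j = inverse (lam j ^ (2 * m)) * v (qp j)" for j
  define b where "b j = inverse (lam j ^ (2 * m)) * v (qm j)" for j
  have smW: "(\<lambda>j. lam j ^ (2 * m) * ((a j)\<^sup>2 + (b j)\<^sup>2)) summable_on {1..}"
    using sm
  proof (rule summable_on_cong[THEN iffD1, rotated])
    fix j :: nat assume "j \<in> {1..}"
    then have "lam j ^ (2 * m) \<noteq> 0" using lam_pos[of j] by simp
    then show "inverse (lam j ^ (2 * m)) * ((v (qp j))\<^sup>2 + (v (qm j))\<^sup>2) = lam j ^ (2 * m) * ((a j)\<^sup>2 + (b j)\<^sup>2)"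
      unfolding a_def b_def by (rule weighted_sum_squares_inverse[symmetric])
  qed
  have "(\<lambda>j. (a j)\<^sup>2 + (b j)\<^sup>2) summable_on {1..}"
  proof (rule summable_on_comparison_test)
    \<comment> \<open>The factor \<open>lam j ^ (2 * m)\<close> divided by
      \<open>lam 1 ^ (2 * m)\<close> is at least 1, so the weighted series dominates the unweighted
      one needed to construct \<open>u\<close>.\<close>
    show "(\<lambda>j. inverse (lam 1 ^ (2 * m)) * (lam j ^ (2 * m) * ((a j)\<^sup>2 + (b j)\<^sup>2))) summable_on {1..}"
      by (intro summable_on_cmult_right smW)
    fix j :: nat assume "j \<in> {1..}"
    then have "lam 1 ^ (2 * m) \<le> lam j ^ (2 * m)"
      using lam_ge[of j] lam_pos[of 1] by (intro power_mono) auto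
    then have "1 \<le> inverse (lam 1 ^ (2 * m)) * lam j ^ (2 * m)"
      using lam_pos[of 1] by (simp add: field_simps)
    then show "(a j)\<^sup>2 + (b j)\<^sup>2 \<le> inverse (lam 1 ^ (2 * m)) * (lam j ^ (2 * m) * ((a j)\<^sup>2 + (b j)\<^sup>2))"
      using mult_right_mono[of 1 "inverse (lam 1 ^ (2 * m)) * lam j ^ (2 * m)" "(a j)\<^sup>2 + (b j)\<^sup>2"]
      by (simp add: mult.assoc)
  qed simp
  then obtain u where u: "eigen_series a b u" by (rule eigen_series_exists)
  have uW: "u \<in> W G m" by (rule eigen_series_in_W[OF smW u])
  have "solves_rot_eq G qp qm m u v"
    unfolding solves_rot_eq_iff[OF uW]
    using eigen_series_coeffs[OF u] lam_pos by (simp add: a_def b_def less_imp_neq[symmetric])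
  then show "\<exists>u\<in>W G m. solves_rot_eq G qp qm m u v" using uW by blast
qed

text \<open>\<open>S_power\<close> chooses one limit of the series, and limits are unique up to null
  sets. The exponent is even, so the factor \<open>(-1) powi k\<close> is 1 and both signs get the
  same coefficient.\<close>

lemma S_power_even:
  assumes "eigen_series (\<lambda>j. inverse (lam j ^ (2 * m)) * v (qp j)) (\<lambda>j. inverse (lam j ^ (2 * m)) * v (qm j)) u"
  shows "L2_eq G u (S_power G lam qp qm (- 2 * int m) v)"
proof -
  have "S_power G lam qp qm (- 2 * int m) v = (SOME u. eigen_series
      (\<lambda>j. inverse (lam j ^ (2 * m)) * v (qp j)) (\<lambda>j. inverse (lam j ^ (2 * m)) * v (qm j)) u)"
    unfolding S_power_def eigen_series_def power_int_minus_double
    by (simp add: scaleR_add_right)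
  then show ?thesis using someI[of "eigen_series _ _", OF assms] eigen_series_unique[OF assms] by simp
qed

lemma solutions_differ_by_B_H:
  assumes "u \<in> W G m" "solves_rot_eq G qp qm m u v" "u' \<in> W G m" "solves_rot_eq G qp qm m u' v"
  shows "(\<lambda>x. u x - u' x) \<in> B_H G"
proof (rule null_field_in_B_H[OF G(1,2)])
  show "L2_eq G (\<lambda>x. u x - u' x) (\<lambda>_. 0)"
    using eigen_series_unique[OF solution_eigen_series[OF assms(1,2)] solution_eigen_series[OF assms(3,4)]]
    by (simp add: L2_eq_def)
qed (use assms in \<open>auto intro: L2_diff V0_L2 W_V0\<close>)

end

theorem mainTheorem2:
  fixes G :: "(real^3) set"
    and lam :: "nat \<Rightarrow> real"
    and qp qm :: "nat \<Rightarrow> real^3 \<Rightarrow> real^3"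
    and m :: nat
    and v :: "(real^3 \<Rightarrow> real^3) \<Rightarrow> real"
  assumes "smooth_bounded_domain G"
    and "curl_eigenbasis G lam qp qm"
    and "m \<ge> 1"
    and "v \<in> B_star G lam qp qm"
  shows "((\<exists>u\<in>W G m. solves_rot_eq G qp qm m u v) \<longleftrightarrow> v \<in> W_neg G lam qp qm m) \<and>
    (\<forall>u\<in>W G m. solves_rot_eq G qp qm m u v \<longrightarrow>
       L2_eq G u (S_power G lam qp qm (- 2 * int m) v) \<and>
       L2_sums G (\<lambda>j x. lam j powi (- 2 * int m) *\<^sub>R
          (v (qp j) *\<^sub>R qp j x + v (qm j) *\<^sub>R qm j x)) u) \<and>
    (\<forall>u\<in>W G m. \<forall>u'\<in>W G m. solves_rot_eq G qp qm m u v \<longrightarrow> solves_rot_eq G qp qm m u' v \<longrightarrow>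
       (\<lambda>x. u x - u' x) \<in> B_H G)"
proof -
  interpret curl_spectrum G lam qp qm using assms(1,2) by unfold_locales
  have "L2_sums G (\<lambda>j x. lam j powi (- 2 * int m) *\<^sub>R (v (qp j) *\<^sub>R qp j x + v (qm j) *\<^sub>R qm j x)) u"
    if "u \<in> W G m" "solves_rot_eq G qp qm m u v" for u
    using solution_eigen_series[OF that]
    unfolding eigen_series_def power_int_minus_double by (simp add: scaleR_add_right)
  then show ?thesis
    using solvable_iff[OF assms(4)] S_power_even[OF solution_eigen_series[of _ _ v]] solutions_differ_by_B_H
    by blast
qed

end
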